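(* Let $H$ be a critical 3-uniform hypergraph. Then $H$ is realizable if and only if $v(H)$ is odd and $H$ is isomorphic to $C_3(T_{v(H)})$, $C_3(U_{v(H)})$ or $C_3(W_{v(H)})$.
   Context: All structures are finite. A 3-uniform hypergraph $H$ consists of a vertex set $V(H)$ and an edge set $E(H)\subseteq\binom{V(H)}{3}$; $v(H)=|V(H)|$. For $v\in V(H)$, $H-v$ is the subhypergraph of $H$ induced by $V(H)\setminus\{v\}$ (its edges are the edges of $H$ not containing $v$). A subset $M$ of $V(H)$ is a module of $H$ if for each $e\in E(H)$ such that $e\cap M\neq\emptyset$ and $e\setminus M\neq\emptyset$, there exists $m\in M$ such that $e\cap M=\{m\}$ and for every $n\in M$, $(e\setminus\{m\})\cup\{n\}\in E(H)$. The sets $\emptyset$, $V(H)$ and $\{v\}$ ($v\in V(H)$) are modules, called trivial. $H$ is decomposable if it has a nontrivial module; $H$ is prime if $v(H)\geq 3$ and all its modules are trivial. $H$ is critical if $H$ is prime and $H-v$ is decomposable for every $v\in V(H)$. A 3-cycle is a tournament on three vertices isomorphic to $(\{0,1,2\},\{01,12,20\})$. The $C_3$-structure $C_3(T)$ of a tournament $T$ is the 3-uniform hypergraph on $V(T)$ whose edges are the 3-element subsets $X$ of $V(T)$ such that $T[X]$ is a 3-cycle. A tournament $T$ with $V(T)=V(H)$ is a realization of $H$ if $H=C_3(T)$; $H$ is realizable if it admits a realization. For $n\geq 1$, let $L_{2n+1}$ be the tournament on $\{0,\ldots,2n\}$ with arcs $pq$ for $0\leq p<q\leq 2n$. The following tournaments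 are defined on $\{0,\ldots,2n\}$: $T_{2n+1}$ is obtained from $L_{2n+1}$ by reversing all the arcs between even and odd vertices; $U_{2n+1}$ is obtained from $L_{2n+1}$ by reversing all the arcs between even vertices; $W_{2n+1}$ is obtained from $L_{2n+1}$ by reversing all the arcs between $2n$ and the even elements of $\{0,\ldots,2n-1\}$. *)

theory Defs
  imports "Graph_Theory.Graph_Theory"
begin

record 'a hypergraph =
  hverts :: "'a set"
  hedges :: "'a set set"

definition hypergraph3 :: "'a hypergraph \<Rightarrow> bool" where
  "hypergraph3 H \<longleftrightarrow>
     finite (hverts H) \<and> hedges H \<subseteq> {e. e \<subseteq> hverts H \<and> card e = 3}"

definition hyper_induced :: "'a hypergraph \<Rightarrow> 'a set \<Rightarrow> 'a hypergraph" where
  "hyper_induced H X = \<lparr>hverts = X, hedges = {e \<in> hedges H. e \<subseteq> X}\<rparr>"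

definition hyper_del :: "'a hypergraph \<Rightarrow> 'a \<Rightarrow> 'a hypergraph" where
  "hyper_del H v = hyper_induced H (hverts H - {v})"

definition hyper_iso :: "'a hypergraph \<Rightarrow> 'b hypergraph \<Rightarrow> bool" where
  "hyper_iso H K \<longleftrightarrow>
     (\<exists>f. bij_betw f (hverts H) (hverts K) \<and> hedges K = (\<lambda>e. f ` e) ` hedges H)"

definition hyper_module :: "'a hypergraph \<Rightarrow> 'a set \<Rightarrow> bool" where
  "hyper_module H M \<longleftrightarrow> M \<subseteq> hverts H \<and>
     (\<forall>e \<in> hedges H. e \<inter> M \<noteq> {} \<and> e - M \<noteq> {} \<longrightarrow>
        (\<exists>m \<in> M. e \<inter> M = {m} \<and> (\<forall>n \<in> M. (e - {m}) \<union> {n} \<in> hedges H)))"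

definition trivial_module :: "'a hypergraph \<Rightarrow> 'a set \<Rightarrow> bool" where
  "trivial_module H M \<longleftrightarrow> M = {} \<or> M = hverts H \<or> (\<exists>v \<in> hverts H. M = {v})"

definition hyper_decomposable :: "'a hypergraph \<Rightarrow> bool" where
  "hyper_decomposable H \<longleftrightarrow> (\<exists>M. hyper_module H M \<and> \<not> trivial_module H M)"

definition hyper_prime :: "'a hypergraph \<Rightarrow> bool" where
  "hyper_prime H \<longleftrightarrow>
     card (hverts H) \<ge> 3 \<and> (\<forall>M. hyper_module H M \<longrightarrow> trivial_module H M)"

definition hyper_critical :: "'a hypergraph \<Rightarrow> bool" where
  "hyper_critical H \<longleftrightarrow>
     hyper_prime H \<and> (\<forall>v \<in> hverts H. hyper_decomposable (hyper_del H v))"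

text \<open>The locale \<open>pair_digraph\<close> requires finiteness and the absence of loops.\<close>

definition tournament :: "'a pair_pre_digraph \<Rightarrow> bool" where
  "tournament T \<longleftrightarrow> pair_digraph T \<and>
     (\<forall>u \<in> pverts T. \<forall>v \<in> pverts T. u \<noteq> v \<longrightarrow> ((u, v) \<in> parcs T \<longleftrightarrow> (v, u) \<notin> parcs T))"

definition three_cycle :: "nat pair_pre_digraph" where
  "three_cycle = \<lparr>pverts = {0, 1, 2}, parcs = {(0, 1), (1, 2), (2, 0)}\<rparr>"

definition C3 :: "'a pair_pre_digraph \<Rightarrow> 'a hypergraph" where
  "C3 T = \<lparr>hverts = pverts T,
     hedges = {X. X \<subseteq> pverts T \<and> card X = 3 \<and>
                  digraph_iso (with_proj T \<restriction> X) (with_proj three_cycle)}\<rparr>"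

definition realization :: "'a pair_pre_digraph \<Rightarrow> 'a hypergraph \<Rightarrow> bool" where
  "realization T H \<longleftrightarrow> tournament T \<and> pverts T = hverts H \<and> H = C3 T"

definition realizable :: "'a hypergraph \<Rightarrow> bool" where
  "realizable H \<longleftrightarrow> (\<exists>T. realization T H)"

text \<open>
  The parameter \<open>m\<close> below is the number of vertices, so that \<open>m = 2n + 1\<close> gives the
  tournaments on \<open>{0, \<dots>, 2n}\<close>, with last vertex \<open>m - 1 = 2n\<close>;
  these definitions are meant for odd \<open>m\<close> only.
\<close>

definition tour_L :: "nat \<Rightarrow> nat pair_pre_digraph" where
  "tour_L m = \<lparr>pverts = {0..<m}, parcs = {(p, q). p < q \<and> q < m}\<rparr>"

definition reverse_between ::
  "'a set \<Rightarrow> 'a set \<Rightarrow> 'a pair_pre_digraph \<Rightarrow> 'a pair_pre_digraph" where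
  "reverse_between A B T = \<lparr>pverts = pverts T,
     parcs = {(p, q). if (p \<in> A \<and> q \<in> B) \<or> (p \<in> B \<and> q \<in> A)
                      then (q, p) \<in> parcs T else (p, q) \<in> parcs T}\<rparr>"

definition tour_T :: "nat \<Rightarrow> nat pair_pre_digraph" where
  "tour_T m = reverse_between {p. even p} {p. odd p} (tour_L m)"

definition tour_U :: "nat \<Rightarrow> nat pair_pre_digraph" where
  "tour_U m = reverse_between {p. even p} {p. even p} (tour_L m)"

definition tour_W :: "nat \<Rightarrow> nat pair_pre_digraph" where
  "tour_W m = reverse_between {m - 1} {p \<in> {0..<m - 1}. even p} (tour_L m)"

end

theory Submission
  imports Defs
begin

text \<open>A tournament \<open>T\<close> is prime iff \<open>C\<^sub>3(T)\<close> is, so the realizations of a critical hypergraph are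
  critical tournaments. By the theorem of Ehrenfeucht and Rozenberg a prime subtournament can be
  enlarged by two vertices at a time. Hence a critical \<open>T\<close> has an odd number of vertices, and
  \<open>T - {x, y}\<close> is prime for some \<open>x \<noteq> y\<close>. Join \<open>x\<close> and \<open>y\<close> in this case. In the resulting graph
  every vertex has degree at most two: if \<open>x\<close> has two neighbours, they are twins in \<open>T - x\<close>;
  if \<open>x\<close> has a single neighbour \<open>y\<close>, then \<open>y\<close> does not distinguish the vertices other than \<open>x\<close>.
  These relations determine the arcs along a longest path up to the parities of the indices,
  and a longest path that closes up to a cycle, has an odd, or has an even number of
  vertices leads to \<open>T\<close>, \<open>U\<close>, or \<open>W\<close> respectively.\<close>

section \<open>Modules and the Ehrenfeucht--Rozenberg theorem\<close>

text \<open>The neighbours \<open>p i\<close> and \<open>p (i + 2)\<close> of an inner path vertex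
  look alike from every vertex except \<open>p (i + 1)\<close>. So the arc between
  \<open>p i\<close> and \<open>p j\<close>, \<open>i < j\<close>, depends only on the parities of
  \<open>i\<close> and \<open>j\<close>; four bits describe the tournament on the path, and
  primality leaves one choice up to reversal of the path. The delicate points are the ends of the
  path and the vertices off it. Of being longest, only this is used: no neighbour of an end lies off
  the path. It confines a second neighbour of \<open>p 0\<close> to \<open>p k\<close>, so the path
  either closes up or each end has a single neighbour. Parity then bounds the vertices off the path:
  there are none, or exactly one if an open path has an even number of vertices. Both directions of
  the primality equivalence are needed: \<open>H\<close> prime must give \<open>T\<close> prime, and
  \<open>H - v\<close> decomposable must give \<open>T - v\<close> not prime. The second is the
  harder one, since a module of \<open>C3(T)\<close> need not be a module of \<open>T\<close>: if
  \<open>T\<close> is transitive, every vertex set is a module of \<open>C3(T)\<close>.\<close>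

text \<open>Comparing only the arcs leaving \<open>x\<close> suffices, as in a tournament they determine those
  entering \<open>x\<close>.\<close>

definition arc_module :: "('a \<Rightarrow> 'a \<Rightarrow> bool) \<Rightarrow> 'a set \<Rightarrow> 'a set \<Rightarrow> bool" where
  "arc_module E V M \<longleftrightarrow> M \<subseteq> V \<and> (\<forall>x \<in> V - M. \<forall>a \<in> M. \<forall>b \<in> M. E x a \<longleftrightarrow> E x b)"

definition arc_prime :: "('a \<Rightarrow> 'a \<Rightarrow> bool) \<Rightarrow> 'a set \<Rightarrow> bool" where
  "arc_prime E V \<longleftrightarrow> card V \<ge> 3 \<and>
     (\<forall>M. arc_module E V M \<longrightarrow> M = {} \<or> M = V \<or> (\<exists>v. M = {v}))"

text \<open>The relation lives on the whole type and the vertex set is separate, so that a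
  subtournament is the same \<open>E\<close> on a smaller set and modules of different vertex sets
  can be compared directly.\<close>

locale arc_tournament =
  fixes E :: "'a \<Rightarrow> 'a \<Rightarrow> bool" and V :: "'a set"
  assumes fin: "finite V"
    and irrefl: "x \<in> V \<Longrightarrow> \<not> E x x"
    and asym: "x \<in> V \<Longrightarrow> y \<in> V \<Longrightarrow> x \<noteq> y \<Longrightarrow> E x y \<longleftrightarrow> \<not> E y x"

lemma arc_moduleD:
  "arc_module E V M \<Longrightarrow> x \<in> V \<Longrightarrow> x \<notin> M \<Longrightarrow> a \<in> M \<Longrightarrow> b \<in> M \<Longrightarrow> E x a \<longleftrightarrow> E x b"
  unfolding arc_module_def by blast

lemma arc_module_restrict:
  "arc_module E V M \<Longrightarrow> X \<subseteq> V \<Longrightarrow> arc_module E X (M \<inter> X)"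
  unfolding arc_module_def by blast

lemma arc_module_pair:
  "arc_module E V {u, x} \<longleftrightarrow> u \<in> V \<and> x \<in> V \<and> (\<forall>w \<in> V. w \<noteq> u \<longrightarrow> w \<noteq> x \<longrightarrow> (E w u \<longleftrightarrow> E w x))"
  unfolding arc_module_def by auto

lemma arc_prime_module_eq:
  "arc_prime E V \<Longrightarrow> arc_module E V M \<Longrightarrow> a \<in> M \<Longrightarrow> b \<in> M \<Longrightarrow> a \<noteq> b \<Longrightarrow> M = V"
  unfolding arc_prime_def by blast

text \<open>A module of a larger tournament meets a prime vertex set in a module of the latter,
  hence trivially. All extension lemmas below run through these three cases.\<close>

lemma arc_prime_module_cases:
  assumes "arc_prime E X" "arc_module E V M" "X \<subseteq> V"
  obtains "M \<inter> X = {}" | "X \<subseteq> M" | u where "u \<in> X" "M \<inter> X = {u}"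
proof -
  have "arc_module E X (M \<inter> X)" using assms arc_module_restrict by blast
  then have "M \<inter> X = {} \<or> M \<inter> X = X \<or> (\<exists>v. M \<inter> X = {v})"
    using assms(1) unfolding arc_prime_def by blast
  then show thesis using that by blast
qed

lemma arc_prime_finite: "arc_prime E X \<Longrightarrow> finite X"
  unfolding arc_prime_def using card.infinite by fastforce

lemma arc_prime_ex_other:
  assumes "arc_prime E X"
  obtains a where "a \<in> X" "a \<noteq> u" "a \<noteq> v"
proof -
  have "card {u, v} < card X"
    using assms card_insert_le_m1[of 2 "{v}" u] unfolding arc_prime_def by (simp add: card_insert_if split: if_splits)
  then have "\<not> X \<subseteq> {u, v}" using card_mono[of "{u, v}" X] by auto
  then show thesis using that by blast
qed

lemma not_arc_prime:
  assumes "\<not> arc_prime E V" "card V \<ge> 3"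
  obtains M a b where "arc_module E V M" "a \<in> M" "b \<in> M" "a \<noteq> b" "M \<noteq> V"
  using assms unfolding arc_prime_def by blast

section \<open>Extensions of a prime vertex set by one or two vertices\<close>

context arc_tournament
begin

lemma sub: "X \<subseteq> V \<Longrightarrow> arc_tournament E X"
  by unfold_locales (use fin irrefl asym finite_subset in blast)+

text \<open>The classes \<open>\<langle>X\<rangle>\<close>, \<open>X(u)\<close> and \<open>Ext(X)\<close> of Ehrenfeucht and Rozenberg correspond below to the
  conditions \<open>arc_module E (insert x X) X\<close>, \<open>arc_module E (insert x X) {u, x}\<close> and
  \<open>arc_prime E (insert x X)\<close>.\<close>

lemma extension_cases:
  assumes X: "arc_prime E X" and x: "x \<notin> X" and np: "\<not> arc_prime E (insert x X)"
  shows "arc_module E (insert x X) X \<or> (\<exists>u \<in> X. arc_module E (insert x X) {u, x})"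
proof -
  have "card (insert x X) \<ge> 3"
    using X arc_prime_finite[OF X] x unfolding arc_prime_def by simp
  then obtain M a b where M: "arc_module E (insert x X) M" "a \<in> M" "b \<in> M" "a \<noteq> b" "M \<noteq> insert x X"
    using not_arc_prime[OF np] by metis
  have Ms: "M \<subseteq> insert x X" using M(1) unfolding arc_module_def by blast
  have "X \<subseteq> insert x X" by blast
  then show ?thesis
  proof (cases rule: arc_prime_module_cases[OF X M(1), consumes 1])
    case 1
    then show ?thesis using M Ms by blast
  next
    case 2
    then have "M = X" using M Ms by blast
    then show ?thesis using M by blast
  next
    case (3 u)
    then have "M \<subseteq> {u, x}" using Ms by blast
    then have "M = {u, x}" using M(2-4) by blast
    then show ?thesis using M 3 by blast
  qed
qed

text \<open>If \<open>x\<close> treats all of \<open>X\<close> alike and is a twin of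
  \<open>u\<close>, then \<open>u\<close> treats all of \<open>X - {u}\<close> alike, which makes
  \<open>X - {u}\<close> a nontrivial module of \<open>X\<close>. Thus the classes of Ehrenfeucht
  and Rozenberg do not overlap here.\<close>

lemma extension_disjoint:
  assumes X: "arc_prime E X" "X \<subseteq> V" and x: "x \<in> V" "x \<notin> X"
    and m: "arc_module E (insert x X) X" and u: "u \<in> X" "arc_module E (insert x X) {u, x}"
  shows False
proof -
  have *: "E a u \<longleftrightarrow> E a x" if "a \<in> X" "a \<noteq> u" for a
    using u that x unfolding arc_module_pair by blast
  have "arc_module E X (X - {u})"
    unfolding arc_module_def
  proof (intro conjI ballI)
    fix z a b assume h: "z \<in> X - (X - {u})" "a \<in> X - {u}" "b \<in> X - {u}"
    have "E u c \<longleftrightarrow> E x c" if "c \<in> X" "c \<noteq> u" for c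
    proof -
      have "c \<in> V" "c \<noteq> x" "u \<in> V" using that X u x by auto
      then show ?thesis using *[of c] asym[of c u] asym[of c x] that x by blast
    qed
    moreover have "E x a \<longleftrightarrow> E x b" using m h x unfolding arc_module_def by blast
    ultimately show "E z a \<longleftrightarrow> E z b" using h by auto
  qed blast
  moreover obtain a where a: "a \<in> X" "a \<noteq> u" "a \<noteq> u" using arc_prime_ex_other[OF X(1)] .
  moreover obtain b where b: "b \<in> X" "b \<noteq> u" "b \<noteq> a" using arc_prime_ex_other[OF X(1)] .
  ultimately have "X - {u} = X" using arc_prime_module_eq[OF X(1), of "X - {u}" a b] by blast
  then show False using u by blast
qed

text \<open>Two twins of \<open>x\<close> in \<open>X\<close> are twins of each other, and
  \<open>{u, v}\<close> is then a nontrivial module of \<open>X\<close>.\<close>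

lemma extension_twin_unique:
  assumes X: "arc_prime E X" "X \<subseteq> V" and x: "x \<in> V" "x \<notin> X"
    and u: "u \<in> X" "arc_module E (insert x X) {u, x}"
    and v: "v \<in> X" "arc_module E (insert x X) {v, x}"
  shows "u = v"
proof (rule ccontr)
  assume "u \<noteq> v"
  moreover have "arc_module E X {u, v}"
    using u v x unfolding arc_module_pair by blast
  ultimately have "{u, v} = X" using arc_prime_module_eq[OF X(1), of "{u, v}" u v] by blast
  moreover obtain a where "a \<in> X" "a \<noteq> u" "a \<noteq> v" using arc_prime_ex_other[OF X(1)] .
  ultimately show False by blast
qed

text \<open>Says that \<open>x\<close> treats \<open>y\<close> like the vertices of
  \<open>X\<close>; this is what makes the complement of the class of \<open>x\<close> a module in
  the theorem below. A nontrivial module of \<open>X\<close> with \<open>x\<close>, \<open>y\<close>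
  added either contains \<open>X\<close> and \<open>y\<close> but not \<open>x\<close>, or is
  \<open>{u, y}\<close> with \<open>u\<close> in \<open>X\<close>; every other shape puts
  \<open>x\<close> or \<open>y\<close> into a class excluded by the hypotheses.\<close>

lemma extension_pair_below:
  assumes X: "arc_prime E X" "X \<subseteq> V" and x: "x \<in> V" "x \<notin> X" and y: "y \<in> V" "y \<notin> X" "x \<noteq> y"
    and xm: "arc_module E (insert x X) X" and ym: "\<not> arc_module E (insert y X) X"
    and np: "\<not> arc_prime E (insert x (insert y X))" and a: "a \<in> X"
  shows "E x y \<longleftrightarrow> E x a"
proof -
  let ?Y = "insert x (insert y X)"
  have "card ?Y \<ge> 3"
    using X arc_prime_finite[OF X(1)] x y unfolding arc_prime_def by simp
  then obtain M c d where M: "arc_module E ?Y M" "c \<in> M" "d \<in> M" "c \<noteq> d" "M \<noteq> ?Y"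
    using not_arc_prime[OF np] by metis
  have Ms: "M \<subseteq> ?Y" using M(1) unfolding arc_module_def by blast
  have MD: "E w p \<longleftrightarrow> E w q" if "w \<in> ?Y" "w \<notin> M" "p \<in> M" "q \<in> M" for w p q
    using arc_moduleD[OF M(1)] that by blast
  have XX: "X \<subseteq> ?Y" by blast
  have xX: "E x p \<longleftrightarrow> E x q" if "p \<in> X" "q \<in> X" for p q
    using xm that x unfolding arc_module_def by blast
  from XX show ?thesis
  proof (cases rule: arc_prime_module_cases[OF X(1) M(1), consumes 1])
    case 1
    then have "M = {x, y}" using M Ms by blast
    then have "E p x \<longleftrightarrow> E p y" if "p \<in> X" for p using MD[of p x y] that x y by auto
    then have "E y p \<longleftrightarrow> E y q" if "p \<in> X" "q \<in> X" for p q
      using xX[of p q] that x y X asym by (metis subsetD)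
    then have "arc_module E (insert y X) X" unfolding arc_module_def by blast
    then show ?thesis using ym by blast
  next
    case 2
    show ?thesis
    proof (cases "y \<in> M")
      case True
      then have "x \<notin> M" using 2 M Ms by blast
      then show ?thesis using MD[of x y a] True 2 a by blast
    next
      case False
      then have "arc_module E (insert y X) X" using 2 MD unfolding arc_module_def by blast
      then show ?thesis using ym by blast
    qed
  next
    case (3 u)
    show ?thesis
    proof (cases "x \<in> M")
      case True
      then have "E p u \<longleftrightarrow> E p x" if "p \<in> X" "p \<noteq> u" for p
        using MD[of p u x] that 3 by blast
      then have "arc_module E (insert x X) {u, x}" unfolding arc_module_pair using 3 by blast
      then show ?thesis using extension_disjoint[OF X x xm] 3 by blast
    next
      case False
      then have "M \<subseteq> {u, y}" using Ms 3 by blast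
      then have "M = {u, y}" using M(2-4) by blast
      then show ?thesis using MD[of x y u] xX[of u a] 3 a False by blast
    qed
  qed
qed

text \<open>Counterpart of \<open>extension_pair_below\<close> for the class of twins of
  \<open>u\<close>: a vertex outside the class does not separate \<open>u\<close> from its twin
  \<open>x\<close>. Hence the class together with \<open>u\<close> becomes a module in the theorem
  below.\<close>

lemma extension_pair_twin:
  assumes X: "arc_prime E X" "X \<subseteq> V" and x: "x \<in> V" "x \<notin> X" and y: "y \<in> V" "y \<notin> X" "x \<noteq> y"
    and u: "u \<in> X" "arc_module E (insert x X) {u, x}" and yu: "\<not> arc_module E (insert y X) {u, y}"
    and np: "\<not> arc_prime E (insert x (insert y X))"
  shows "E y u \<longleftrightarrow> E y x"
proof -
  let ?Y = "insert x (insert y X)"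
  have "card ?Y \<ge> 3"
    using X arc_prime_finite[OF X(1)] x y unfolding arc_prime_def by simp
  then obtain M c d where M: "arc_module E ?Y M" "c \<in> M" "d \<in> M" "c \<noteq> d" "M \<noteq> ?Y"
    using not_arc_prime[OF np] by metis
  have Ms: "M \<subseteq> ?Y" using M(1) unfolding arc_module_def by blast
  have MD: "E w p \<longleftrightarrow> E w q" if "w \<in> ?Y" "w \<notin> M" "p \<in> M" "q \<in> M" for w p q
    using arc_moduleD[OF M(1)] that by blast
  have XX: "X \<subseteq> ?Y" by blast
  have ux: "E p u \<longleftrightarrow> E p x" if "p \<in> X" "p \<noteq> u" for p
    using u that x unfolding arc_module_pair by blast
  from XX show ?thesis
  proof (cases rule: arc_prime_module_cases[OF X(1) M(1), consumes 1])
    case 1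
    then have "M = {x, y}" using M Ms by blast
    then have "E p x \<longleftrightarrow> E p y" if "p \<in> X" for p using MD[of p x y] that x y by auto
    then have "arc_module E (insert y X) {u, y}" unfolding arc_module_pair using ux u by blast
    then show ?thesis using yu by blast
  next
    case 2
    show ?thesis
    proof (cases "x \<in> M")
      case True
      then have "y \<notin> M" using 2 M Ms by blast
      then show ?thesis using MD[of y u x] True 2 u by blast
    next
      case False
      then have "arc_module E (insert x X) X" using 2 MD unfolding arc_module_def by blast
      then show ?thesis using extension_disjoint[OF X x _ u] by blast
    qed
  next
    case (3 v)
    show ?thesis
    proof (cases "x \<in> M")
      case True
      then have "E p v \<longleftrightarrow> E p x" if "p \<in> X" "p \<noteq> v" for p
        using MD[of p v x] that 3 by blast
      then have "arc_module E (insert x X) {v, x}" unfolding arc_module_pair using 3 by blast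
      then have uv: "u = v" using extension_twin_unique[OF X x u] 3 by blast
      have "y \<notin> M"
      proof
        assume "y \<in> M"
        then have "E p v \<longleftrightarrow> E p y" if "p \<in> X" "p \<noteq> v" for p
          using MD[of p v y] that 3 by blast
        then have "arc_module E (insert y X) {u, y}" unfolding arc_module_pair using 3 uv by blast
        then show False using yu by blast
      qed
      then show ?thesis using MD[of y u x] 3 True uv by blast
    next
      case False
      then have "M \<subseteq> {v, y}" using Ms 3 by blast
      then have "M = {v, y}" using M(2-4) by blast
      then have yM: "y \<in> M" by blast
      then have vy: "E p v \<longleftrightarrow> E p y" if "p \<in> X" "p \<noteq> v" for p
        using MD[of p v y] that 3 by blast
      then have "arc_module E (insert y X) {v, y}" unfolding arc_module_pair using 3 by blast
      then have uv: "u \<noteq> v" using yu by blast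
      \<comment> \<open>Here \<open>y\<close> is a twin of some \<open>v\<close> different from
        \<open>u\<close>. The arc between \<open>y\<close> and \<open>x\<close> agrees with that
        between \<open>v\<close> and \<open>x\<close>, this one with that between \<open>v\<close>
        and \<open>u\<close>, and this one with that between \<open>y\<close> and
        \<open>u\<close>.\<close>
      have "E x v \<longleftrightarrow> E x y" using MD[of x v y] 3 yM False by blast
      moreover have "E u v \<longleftrightarrow> E u y" using vy uv u by blast
      moreover have "E v u \<longleftrightarrow> E v x" using ux uv 3 by blast
      moreover have "x \<noteq> v" "y \<noteq> u" "u \<in> V" "v \<in> V" using X x y u 3 by auto
      ultimately show ?thesis using asym[of x v] asym[of u v] asym[of x y] asym[of u y] x y uv by blast
    qed
  qed
qed

text \<open>Apply \<open>extension_cases\<close> to the prime set \<open>insert x X\<close> and the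
  vertex \<open>y\<close>. The only outcome that does not restrict to a nontrivial module of the
  prime set \<open>insert y X\<close> is that \<open>x\<close> and \<open>y\<close> are
  twins.\<close>

lemma extension_pair_ext:
  assumes X: "arc_prime E X" "X \<subseteq> V" and x: "x \<in> V" "x \<notin> X" and y: "y \<in> V" "y \<notin> X" "x \<noteq> y"
    and xp: "arc_prime E (insert x X)" and yp: "arc_prime E (insert y X)"
    and np: "\<not> arc_prime E (insert x (insert y X))" and a: "a \<in> X"
  shows "E a x \<longleftrightarrow> E a y"
proof -
  let ?Y = "insert y (insert x X)"
  obtain b where b: "b \<in> X" "b \<noteq> a" "b \<noteq> a" using arc_prime_ex_other[OF X(1)] .
  have "?Y = insert x (insert y X)" by blast
  then have "arc_module E ?Y (insert x X) \<or> (\<exists>u \<in> insert x X. arc_module E ?Y {u, y})"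
    using extension_cases[OF xp, of y] y np by auto
  then obtain u where u: "u \<in> insert x X" "arc_module E ?Y {u, y}"
  proof
    assume "arc_module E ?Y (insert x X)"
    then have "arc_module E (insert y X) X" using y unfolding arc_module_def by blast
    then have "X = insert y X" using arc_prime_module_eq[OF yp, of X a b] a b by blast
    then show thesis using y by blast
  qed (use that in blast)
  have "u = x"
  proof (rule ccontr)
    assume "u \<noteq> x"
    then have uX: "u \<in> X" using u by blast
    then have "arc_module E (insert y X) {u, y}" using u unfolding arc_module_pair by blast
    then have "{u, y} = insert y X"
      using arc_prime_module_eq[OF yp, of "{u, y}" u y] uX y by blast
    then have "a \<in> {u, y}" "b \<in> {u, y}" using a b by auto
    then show False using a b y by blast
  qed
  then show ?thesis using u x y a unfolding arc_module_pair by auto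
qed

text \<open>If no pair works, the three pair lemmas apply to all pairs outside \<open>X\<close>.
  They turn each class into a module or the complement of one, so primality of \<open>V\<close>
  empties the class of uniform vertices and all twin classes. Every outside vertex then extends
  \<open>X\<close> to a prime set, and \<open>V - X\<close> is itself a nontrivial module.\<close>

lemma ehrenfeucht_rozenberg:
  assumes V: "arc_prime E V" and X: "arc_prime E X" "X \<subseteq> V" and d: "card (V - X) \<ge> 2"
  obtains x y where "x \<in> V - X" "y \<in> V - X" "x \<noteq> y" "arc_prime E (insert x (insert y X))"
proof (rule ccontr)
  assume no: "\<not> thesis"
  note found = that
  have np: "\<not> arc_prime E (insert x (insert y X))" if "x \<in> V" "x \<notin> X" "y \<in> V" "y \<notin> X" "x \<noteq> y" for x y
  proof
    assume "arc_prime E (insert x (insert y X))"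
    then have thesis using \<open>x \<in> V\<close> \<open>x \<notin> X\<close> \<open>y \<in> V\<close> \<open>y \<notin> X\<close> \<open>x \<noteq> y\<close> by (intro found[of x y]) auto
    then show False using no by contradiction
  qed
  obtain s t where st: "s \<in> V" "t \<in> V" "s \<notin> X" "t \<notin> X" "s \<noteq> t"
    using d by (metis Diff_iff card_le_Suc0_iff_eq card.infinite not_less_eq_eq numeral_2_eq_2 zero_le)
  obtain p where p: "p \<in> X" "p \<noteq> s" "p \<noteq> s" using arc_prime_ex_other[OF X(1)] .
  obtain q where q: "q \<in> X" "q \<noteq> p" "q \<noteq> p" using arc_prime_ex_other[OF X(1)] .
  have nb: "\<not> arc_module E (insert x X) X" if x: "x \<in> V" "x \<notin> X" for x
  proof
    assume xm: "arc_module E (insert x X) X"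
    \<comment> \<open>No vertex of \<open>B\<close> separates two vertices of \<open>V - B\<close>,
      which contains \<open>X\<close>; so \<open>V - B\<close> is a module with at least two
      elements.\<close>
    define B where "B = {z \<in> V - X. arc_module E (insert z X) X}"
    have *: "E z a \<longleftrightarrow> E z p" if z: "z \<in> B" and a: "a \<in> V - B" for z a
    proof (cases "a \<in> X")
      case True
      then show ?thesis using z p unfolding B_def arc_module_def by blast
    next
      case False
      then show ?thesis using extension_pair_below[OF X, of z a p] z a p np[of z a] unfolding B_def by blast
    qed
    have "arc_module E V (V - B)" unfolding arc_module_def
    proof (intro conjI ballI)
      fix z a b assume "z \<in> V - (V - B)" "a \<in> V - B" "b \<in> V - B"
      then show "E z a \<longleftrightarrow> E z b" using *[of z a] *[of z b] by blast
    qed blast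
    moreover have "p \<in> V - B" "q \<in> V - B" using p q X unfolding B_def by auto
    ultimately have "V - B = V" using arc_prime_module_eq[OF V, of "V - B" p q] q by blast
    moreover have "x \<in> B" using x xm unfolding B_def by blast
    ultimately show False using x by blast
  qed
  have nt: "\<not> arc_module E (insert x X) {u, x}" if x: "x \<in> V" "x \<notin> X" and u: "u \<in> X" for x u
  proof
    assume xm: "arc_module E (insert x X) {u, x}"
    \<comment> \<open>Adding \<open>u\<close> to its twins makes this a module with at least two
      elements. It cannot be \<open>V\<close>, because it meets \<open>X\<close> only in
      \<open>u\<close>.\<close>
    define B where "B = insert u {z \<in> V - X. arc_module E (insert z X) {u, z}}"
    have *: "E w z \<longleftrightarrow> E w u" if z: "z \<in> B" and w: "w \<in> V - B" for z w
    proof (cases "z = u")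
      case False
      then have z': "z \<in> V" "z \<notin> X" "arc_module E (insert z X) {u, z}" using z unfolding B_def by auto
      have w': "w \<in> V" "w \<noteq> u" "w \<noteq> z" using z w unfolding B_def by auto
      show ?thesis
      proof (cases "w \<in> X")
        case True
        then show ?thesis using z' w' unfolding arc_module_pair by blast
      next
        case False
        then have "\<not> arc_module E (insert w X) {u, w}" using w unfolding B_def by blast
        then show ?thesis using extension_pair_twin[OF X, of z w u] u z' w' False np[of z w] by blast
      qed
    qed simp
    have "arc_module E V B" unfolding arc_module_def
    proof (intro conjI ballI)
      fix z a b assume "z \<in> V - B" "a \<in> B" "b \<in> B"
      then show "E z a \<longleftrightarrow> E z b" using *[of a z] *[of b z] by blast
    qed (use u X in \<open>auto simp: B_def\<close>)
    moreover have "u \<in> B" "x \<in> B" "u \<noteq> x" using x u xm unfolding B_def by auto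
    ultimately have "B = V" using arc_prime_module_eq[OF V] by blast
    moreover have "B \<inter> X \<subseteq> {u}" unfolding B_def by blast
    ultimately have "p = u" "q = u" using p q X by auto
    then show False using q by blast
  qed
  have ext: "arc_prime E (insert x X)" if "x \<in> V" "x \<notin> X" for x
    using extension_cases[OF X(1)] nb nt that by blast
  have "E a x \<longleftrightarrow> E a y" if "x \<in> V" "x \<notin> X" "y \<in> V" "y \<notin> X" "a \<in> X" for x y a
    using extension_pair_ext[OF X, of x y a] ext np[of x y] that by (cases "x = y") auto
  then have "arc_module E V (V - X)" unfolding arc_module_def by blast
  then have "V - X = V" using arc_prime_module_eq[OF V, of "V - X" s t] st by blast
  then show False using p X by blast
qed

end

section \<open>Critical tournaments\<close>

lemma arc_prime_three_cycle:
  assumes "E a b" "E b c" "E c a" "\<not> E b a" "\<not> E c b" "\<not> E a c" "a \<noteq> b" "b \<noteq> c" "a \<noteq> c"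
  shows "arc_prime E {a, b, c}"
  unfolding arc_prime_def
proof (intro conjI allI impI)
  fix M assume M: "arc_module E {a, b, c} M"
  then have "M \<in> Pow {a, b, c}" unfolding arc_module_def by blast
  moreover have "M \<noteq> {a, b}" "M \<noteq> {a, c}" "M \<noteq> {b, c}"
    using arc_moduleD[OF M, of c a b] arc_moduleD[OF M, of b a c] arc_moduleD[OF M, of a b c] assms by auto
  ultimately show "M = {} \<or> M = {a, b, c} \<or> (\<exists>v. M = {v})"
    by (simp add: Pow_insert) blast
qed (use assms in auto)

context arc_tournament
begin

text \<open>Fix \<open>v\<close> and let \<open>M\<close> be \<open>v\<close> with its
  out-neighbours. As \<open>v\<close> has both in- and out-neighbours, \<open>M\<close> is a
  nontrivial candidate, so some \<open>z\<close> outside separates it. Since \<open>z\<close>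
  dominates \<open>v\<close>, it is dominated by some out-neighbour \<open>b\<close> of
  \<open>v\<close>, and \<open>v\<close>, \<open>b\<close>, \<open>z\<close> form the cycle.\<close>

lemma ex_three_cycle:
  assumes V: "arc_prime E V"
  obtains a b c where "a \<in> V" "b \<in> V" "c \<in> V" "E a b" "E b c" "E c a"
proof -
  obtain v where v: "v \<in> V" using arc_prime_ex_other[OF V] by metis
  obtain s where s: "s \<in> V" "s \<noteq> v" "s \<noteq> v" using arc_prime_ex_other[OF V] .
  obtain t where t: "t \<in> V" "t \<noteq> v" "t \<noteq> s" using arc_prime_ex_other[OF V] .
  have nc: "\<not> arc_module E V (V - {v})"
    using arc_prime_module_eq[OF V, of "V - {v}" s t] s t v by blast
  then obtain x y where xy: "x \<in> V" "y \<in> V" "x \<noteq> v" "y \<noteq> v" "E v x" "\<not> E v y"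
    using v unfolding arc_module_def by blast
  define M where "M = insert v {z \<in> V. E v z}"
  have "\<not> arc_module E V M"
    using arc_prime_module_eq[OF V, of M v x] xy unfolding M_def by blast
  then obtain z a b where z: "z \<in> V" "z \<notin> M" "a \<in> M" "b \<in> M" "E z a" "\<not> E z b"
    using v unfolding arc_module_def M_def by blast
  have zv: "E z v" using z asym[of z v] v unfolding M_def by blast
  then have b: "b \<in> V" "E v b" using z unfolding M_def by auto
  then have "E b z" using z asym[of z b] unfolding M_def by blast
  then show thesis using that[of v b z] v b z zv by blast
qed

text \<open>Exchanging \<open>u\<close> for \<open>y\<close> and fixing \<open>Z\<close> is an
  isomorphism of the two subtournaments. The arc between \<open>u\<close> and \<open>y\<close> is
  irrelevant, as the two never occur together.\<close>

lemma twin_swap: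
  assumes P: "arc_prime E (insert u Z)" and sub: "insert y (insert u Z) \<subseteq> V"
    and ne: "u \<notin> Z" "y \<notin> Z" and tw: "\<And>w. w \<in> Z \<Longrightarrow> E w u \<longleftrightarrow> E w y"
  shows "arc_prime E (insert y Z)"
proof -
  have tw': "E u w \<longleftrightarrow> E y w" if "w \<in> Z" for w
    using tw[OF that] asym[of u w] asym[of y w] that ne sub by blast
  have fZ: "finite Z" using arc_prime_finite[OF P] by simp
  have "M = {} \<or> M = insert y Z \<or> (\<exists>v. M = {v})" if M: "arc_module E (insert y Z) M" for M
  proof -
    have Ms: "M \<subseteq> insert y Z" using M unfolding arc_module_def by blast
    \<comment> \<open>\<open>M'\<close> is the preimage of \<open>M\<close> under the exchange
      \<open>f\<close> defined next, so a module of one set is carried back to the other.\<close>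
    define M' where "M' = (if y \<in> M then insert u (M - {y}) else M)"
    define f where "f z = (if z = u then y else z)" for z
    have f: "E (f z) (f a) \<longleftrightarrow> E z a" if "z \<in> insert u Z" "a \<in> insert u Z" "z \<noteq> a" for z a
      using that tw tw' unfolding f_def by auto
    have fM: "f z \<in> M \<longleftrightarrow> z \<in> M'" "f z \<in> insert y Z" if "z \<in> insert u Z" for z
      using that ne Ms unfolding f_def M'_def by auto
    have sub': "M' \<subseteq> insert u Z" using Ms unfolding M'_def by auto
    have "arc_module E (insert u Z) M'" unfolding arc_module_def
    proof (intro conjI ballI sub')
      fix z a b assume h: "z \<in> insert u Z - M'" "a \<in> M'" "b \<in> M'"
      then have "E (f z) (f a) \<longleftrightarrow> E (f z) (f b)"
        using arc_moduleD[OF M, of "f z" "f a" "f b"] fM sub' by blast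
      moreover have "z \<in> insert u Z" "a \<in> insert u Z" "b \<in> insert u Z" "z \<noteq> a" "z \<noteq> b"
        using h sub' by auto
      ultimately show "E z a \<longleftrightarrow> E z b" using f by blast
    qed
    then consider "M' = {}" | "M' = insert u Z" | v where "M' = {v}" using P unfolding arc_prime_def by blast
    then show ?thesis
    proof cases
      case 1
      then show ?thesis unfolding M'_def by (auto split: if_splits)
    next
      case 2
      then have "u \<in> M'" "Z \<subseteq> M'" by auto
      then have "y \<in> M" "Z \<subseteq> M" using Ms ne unfolding M'_def by (auto split: if_splits)
      then show ?thesis using Ms by blast
    next
      case (3 v)
      show ?thesis
      proof (cases "y \<in> M")
        case True
        then have "insert u (M - {y}) = {v}" using 3 unfolding M'_def by simp
        then have "M - {y} \<subseteq> {u}" by blast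
        then have "u = y \<or> M - {y} = {}" using Ms ne by blast
        then have "M \<subseteq> {y}" using \<open>M - {y} \<subseteq> {u}\<close> by blast
        then show ?thesis using True by blast
      next
        case False
        then show ?thesis using 3 unfolding M'_def by auto
      qed
    qed
  qed
  moreover have "card (insert y Z) = card (insert u Z)" using fZ ne by simp
  ultimately show ?thesis using P unfolding arc_prime_def by metis
qed

end

text \<open>The bound \<open>card4\<close> excludes the 3-cycle: it is prime, and its vertex
  deletions have two vertices, so they are not \<open>arc_prime\<close> although they have no
  nontrivial module.\<close>

locale critical_tournament = arc_tournament +
  assumes prime: "arc_prime E V"
    and crit: "v \<in> V \<Longrightarrow> \<not> arc_prime E (V - {v})"
    and card4: "card V \<ge> 4"
begin

text \<open>This is the edge relation of the graph known as the primality graph, or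
  indecomposability graph, of the tournament.\<close>

definition nb :: "'a \<Rightarrow> 'a \<Rightarrow> bool" where
  "nb x y \<longleftrightarrow> x \<in> V \<and> y \<in> V \<and> x \<noteq> y \<and> arc_prime E (V - {x, y})"

lemma nb_sym: "nb x y \<Longrightarrow> nb y x"
  unfolding nb_def by (metis insert_commute)

text \<open>Take a largest proper prime subset of odd size; a 3-cycle is one such set. By
  criticality it misses at least two vertices, so two can be added. The result is prime and odd, and
  by maximality it is all of \<open>V\<close>.\<close>

lemma odd_card_ex_nb: "odd (card V) \<and> (\<exists>x y. nb x y)"
proof -
  define S where "S = {X. X \<subset> V \<and> arc_prime E X \<and> odd (card X)}"
  obtain a b c where abc: "a \<in> V" "b \<in> V" "c \<in> V" "E a b" "E b c" "E c a"
    using ex_three_cycle[OF prime] .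
  then have ne: "a \<noteq> b" "b \<noteq> c" "a \<noteq> c" using irrefl asym by metis+
  then have "arc_prime E {a, b, c}"
    using abc asym[of a b] asym[of b c] asym[of c a] by (intro arc_prime_three_cycle) auto
  moreover have "card {a, b, c} = 3" using ne by simp
  moreover have "{a, b, c} \<noteq> V" using calculation(2) card4 by auto
  ultimately have S0: "{a, b, c} \<in> S" unfolding S_def using abc by auto
  have "\<forall>X. X \<in> S \<longrightarrow> card X < Suc (card V)"
    using fin unfolding S_def by (auto intro: card_mono simp: less_Suc_eq_le)
  from ex_has_greatest_nat[of "\<lambda>X. X \<in> S", OF S0 this] obtain X
    where X: "X \<in> S" "\<And>Y. Y \<in> S \<Longrightarrow> card Y \<le> card X" by auto
  then have XV: "X \<subset> V" "arc_prime E X" "odd (card X)" unfolding S_def by auto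
  have fX: "finite X" using XV fin finite_subset by blast
  have "card (V - X) \<ge> 2"
  proof (rule ccontr)
    assume "\<not> card (V - X) \<ge> 2"
    moreover have "V - X \<noteq> {}" using XV by blast
    then have "card (V - X) \<noteq> 0" using fin by simp
    ultimately have "card (V - X) = 1" by linarith
    then obtain v where "V - X = {v}" by (metis card_1_singletonE)
    then have "X = V - {v}" "v \<in> V" using XV by auto
    then show False using crit XV by blast
  qed
  moreover have "X \<subseteq> V" using XV by blast
  ultimately obtain x y where xy: "x \<in> V - X" "y \<in> V - X" "x \<noteq> y" "arc_prime E (insert x (insert y X))"
    using ehrenfeucht_rozenberg[OF prime XV(2)] by metis
  define Y where "Y = insert x (insert y X)"
  have cY: "card Y = card X + 2" using xy fX unfolding Y_def by simp
  then have "Y \<notin> S" using X(2)[of Y] by auto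
  moreover have "Y \<subseteq> V" "odd (card Y)" "arc_prime E Y" using xy XV cY unfolding Y_def by auto
  ultimately have "Y = V" unfolding S_def by blast
  then have "V - {x, y} = X" using xy unfolding Y_def by blast
  then have "nb x y" using xy XV unfolding nb_def by simp
  then show ?thesis using \<open>Y = V\<close> \<open>odd (card Y)\<close> by blast
qed

lemma card5: "card V \<ge> 5"
  using card4 odd_card_ex_nb by (cases "card V = 4") auto

text \<open>Adding \<open>y\<close> to the prime set \<open>V - {x, y}\<close> gives
  \<open>V - {x}\<close>, which is not prime by criticality, so \<open>extension_cases\<close>
  leaves two outcomes. If \<open>y\<close> has a twin \<open>u\<close> in \<open>V - {x}\<close>,
  exchanging them shows that \<open>V - {x, u}\<close> is prime as well, whence the second
  neighbour. A further neighbour \<open>z\<close> is impossible, since the module found would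
  restrict to a nontrivial module of \<open>V - {x, z}\<close>.\<close>

lemma nb_cases:
  assumes xy: "nb x y"
  obtains "\<And>z. nb x z \<Longrightarrow> z = y" "arc_module E (V - {x}) (V - {x, y})"
  | u where "u \<noteq> y" "nb x u" "\<And>z. nb x z \<Longrightarrow> z = y \<or> z = u" "arc_module E (V - {x}) {u, y}"
proof -
  define X where "X = V - {x, y}"
  have V: "x \<in> V" "y \<in> V" "x \<noteq> y" and X: "arc_prime E X" using xy unfolding nb_def X_def by auto
  have iX: "insert y X = V - {x}" and yX: "y \<notin> X" using V unfolding X_def by auto
  have ex: "\<exists>a b. a \<in> X \<and> b \<in> X \<and> a \<noteq> b \<and> a \<noteq> z \<and> b \<noteq> z" for z
    using arc_prime_ex_other[OF X] by metis
  have "arc_module E (V - {x}) X \<or> (\<exists>u \<in> X. arc_module E (V - {x}) {u, y})"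
    using extension_cases[OF X yX] crit[OF V(1)] unfolding iX by blast
  then show thesis
  proof
    assume M: "arc_module E (V - {x}) X"
    have "z = y" if "nb x z" for z
    proof (rule ccontr)
      assume zy: "z \<noteq> y"
      have z: "z \<in> V" "z \<noteq> x" "arc_prime E (V - {x, z})" using that unfolding nb_def by auto
      have "V - {x, z} \<subseteq> V - {x}" by blast
      then have "arc_module E (V - {x, z}) (X \<inter> (V - {x, z}))" using arc_module_restrict[OF M] by blast
      moreover obtain a b where "a \<in> X" "b \<in> X" "a \<noteq> b" "a \<noteq> z" "b \<noteq> z" using ex by blast
      ultimately have "X \<inter> (V - {x, z}) = V - {x, z}"
        using arc_prime_module_eq[OF z(3), of _ a b] unfolding X_def by blast
      moreover have "y \<in> V - {x, z}" using V zy by auto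
      ultimately show False using yX by blast
    qed
    then show thesis using that(1) M unfolding X_def by blast
  next
    assume "\<exists>u \<in> X. arc_module E (V - {x}) {u, y}"
    then obtain u where u: "u \<in> X" "arc_module E (V - {x}) {u, y}" by blast
    have "insert u (V - {x, y, u}) = X" using u unfolding X_def by blast
    moreover have "insert y (V - {x, y, u}) = V - {x, u}" using V u yX by auto
    moreover have "arc_prime E (insert y (V - {x, y, u}))"
    proof (rule twin_swap)
      show "arc_prime E (insert u (V - {x, y, u}))" using X calculation(1) by simp
      show "insert y (insert u (V - {x, y, u})) \<subseteq> V" using V u unfolding X_def by blast
      show "E w u \<longleftrightarrow> E w y" if "w \<in> V - {x, y, u}" for w
        using arc_moduleD[OF u(2), of w u y] that by blast
    qed auto
    ultimately have xu: "nb x u" using V u unfolding nb_def X_def by auto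
    have "z = y \<or> z = u" if "nb x z" for z
    proof (rule ccontr)
      assume zy: "\<not> (z = y \<or> z = u)"
      have z: "z \<in> V" "z \<noteq> x" "arc_prime E (V - {x, z})" using that unfolding nb_def by auto
      have "V - {x, z} \<subseteq> V - {x}" by blast
      then have "arc_module E (V - {x, z}) ({u, y} \<inter> (V - {x, z}))" using arc_module_restrict[OF u(2)] by blast
      moreover have m: "u \<in> {u, y} \<inter> (V - {x, z})" "y \<in> {u, y} \<inter> (V - {x, z})" "u \<noteq> y"
        using V u yX zy unfolding X_def by auto
      ultimately have "{u, y} \<inter> (V - {x, z}) = V - {x, z}"
        using arc_prime_module_eq[OF z(3)] by blast
      moreover obtain a b where ab: "a \<in> X" "b \<in> X" "a \<noteq> b" "a \<noteq> z" "b \<noteq> z" using ex by blast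
      ultimately have "a \<in> {u, y}" "b \<in> {u, y}" unfolding X_def by blast+
      then show False using ab yX by blast
    qed
    then show thesis using that(2)[of u] u xu yX by blast
  qed
qed

lemma nb_single:
  assumes "nb x y" "\<And>z. nb x z \<Longrightarrow> z = y" "a \<in> V - {x, y}" "b \<in> V - {x, y}"
  shows "E y a \<longleftrightarrow> E y b"
proof (cases rule: nb_cases[OF assms(1)])
  case 1
  then show ?thesis using arc_moduleD[of E "V - {x}" "V - {x, y}" y a b] assms unfolding nb_def by blast
next
  case (2 u)
  then show ?thesis using assms(2) by blast
qed

lemma nb_double:
  assumes "nb x y" "nb x z" "y \<noteq> z"
  shows "nb x w \<Longrightarrow> w = y \<or> w = z"
    and "w \<in> V \<Longrightarrow> w \<notin> {x, y, z} \<Longrightarrow> E w y \<longleftrightarrow> E w z"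
proof -
  have "(nb x w \<longrightarrow> w = y \<or> w = z) \<and> (w \<in> V \<longrightarrow> w \<notin> {x, y, z} \<longrightarrow> (E w y \<longleftrightarrow> E w z))"
  proof (cases rule: nb_cases[OF assms(1)])
    case 1
    then show ?thesis using assms by blast
  next
    case (2 u)
    then have "u = z" using assms by blast
    then show ?thesis using 2 arc_moduleD[OF 2(4), of w u y] by blast
  qed
  then show "nb x w \<Longrightarrow> w = y \<or> w = z"
    and "w \<in> V \<Longrightarrow> w \<notin> {x, y, z} \<Longrightarrow> E w y \<longleftrightarrow> E w z" by blast+
qed

end

section \<open>Longest paths of deletable pairs\<close>

lemma card_ge_2_ex:
  assumes "2 \<le> card A"
  obtains a b where "a \<in> A" "b \<in> A" "a \<noteq> b"
proof -
  have "finite A" using assms card.infinite by fastforce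
  then have "\<not> (\<forall>a \<in> A. \<forall>b \<in> A. a = b)" using card_le_Suc0_iff_eq[of A] assms by auto
  then show thesis using that by blast
qed

text \<open>The path has \<open>k\<close> edges and the \<open>k + 1\<close> vertices
  \<open>p 0, ..., p k\<close>. The assumptions \<open>end0\<close> and \<open>endk\<close> are all
  that is kept of maximality: a neighbour of an end outside the path would extend it.\<close>

locale critical_path = critical_tournament +
  fixes p :: "nat \<Rightarrow> 'a" and k :: nat
  assumes k1: "k \<ge> 1"
    and inj: "inj_on p {..k}"
    and step: "i < k \<Longrightarrow> nb (p i) (p (Suc i))"
    and end0: "nb (p 0) z \<Longrightarrow> z \<in> p ` {..k}"
    and endk: "nb (p k) z \<Longrightarrow> z \<in> p ` {..k}"
begin

text \<open>Supplies the statements about the far end from those about \<open>p 0\<close>, and later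
  allows the direction of the arcs to be normalised.\<close>

lemma reversed: "critical_path E V (\<lambda>i. p (k - i)) k"
proof unfold_locales
  have im: "(\<lambda>i. p (k - i)) ` {..k} = p ` {..k}"
  proof -
    have "(\<lambda>i. k - i) ` {..k} = {..k}"
    proof
      show "{..k} \<subseteq> (\<lambda>i. k - i) ` {..k}"
      proof
        fix i assume "i \<in> {..k}"
        then show "i \<in> (\<lambda>i. k - i) ` {..k}" by (intro image_eqI[of _ _ "k - i"]) auto
      qed
    qed auto
    then show ?thesis using image_image[of p "\<lambda>i. k - i" "{..k}"] by simp
  qed
  show "inj_on (\<lambda>i. p (k - i)) {..k}"
    by (rule inj_onI) (use inj_onD[OF inj] in fastforce)
  show "nb (p (k - i)) (p (k - Suc i))" if "i < k" for i
    using nb_sym[OF step[of "k - Suc i"]] that by (simp add: Suc_diff_Suc)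
  show "z \<in> (\<lambda>i. p (k - i)) ` {..k}" if "nb (p (k - 0)) z" for z using that endk im by simp
  show "z \<in> (\<lambda>i. p (k - i)) ` {..k}" if "nb (p (k - k)) z" for z using that end0 im by simp
qed (rule k1)

lemma pV: "i \<le> k \<Longrightarrow> p i \<in> V"
  using step[of i] step[of "i - 1"] k1 unfolding nb_def
  by (cases "i < k") (auto simp: not_less)

lemma p_eq: "i \<le> k \<Longrightarrow> j \<le> k \<Longrightarrow> p i = p j \<longleftrightarrow> i = j"
  using inj by (auto simp: inj_on_def)

lemma p_flip: "i \<le> k \<Longrightarrow> j \<le> k \<Longrightarrow> i \<noteq> j \<Longrightarrow> E (p i) (p j) \<longleftrightarrow> \<not> E (p j) (p i)"
  using asym pV p_eq by metis

text \<open>The source of all parity arguments: an inner vertex already has its two neighbours on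
  the path, and these are twins once it is removed.\<close>

lemma interior:
  assumes "i + 2 \<le> k"
  shows "nb (p (i + 1)) w \<Longrightarrow> w = p i \<or> w = p (i + 2)"
    and "w \<in> V \<Longrightarrow> w \<noteq> p i \<Longrightarrow> w \<noteq> p (i + 1) \<Longrightarrow> w \<noteq> p (i + 2) \<Longrightarrow> E w (p i) \<longleftrightarrow> E w (p (i + 2))"
proof -
  have "nb (p (i + 1)) (p i)" "nb (p (i + 1)) (p (i + 2))" "p i \<noteq> p (i + 2)"
    using step[of i] step[of "i + 1"] nb_sym assms p_eq by auto
  from nb_double[OF this] show "nb (p (i + 1)) w \<Longrightarrow> w = p i \<or> w = p (i + 2)"
    and "w \<in> V \<Longrightarrow> w \<noteq> p i \<Longrightarrow> w \<noteq> p (i + 1) \<Longrightarrow> w \<noteq> p (i + 2) \<Longrightarrow> E w (p i) \<longleftrightarrow> E w (p (i + 2))"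
    by blast+
qed

text \<open>An inner vertex \<open>p j\<close> has no neighbours besides \<open>p (j - 1)\<close>
  and \<open>p (j + 1)\<close>, so among inner vertices only \<open>p 1\<close> can be adjacent to
  \<open>p 0\<close>.\<close>

lemma nb_end:
  assumes "nb (p 0) z"
  shows "z = p 1 \<or> z = p k"
proof -
  obtain j where j: "j \<le> k" "z = p j" using end0[OF assms] by blast
  moreover have "j \<noteq> 0" by (intro notI) (use assms j in \<open>auto simp: nb_def\<close>)
  moreover have "j = 1" if "0 < j" "j < k"
  proof -
    have "j - 1 + 2 \<le> k" "j - 1 + 1 = j" using that by auto
    then have "p 0 = p (j - 1) \<or> p 0 = p (j - 1 + 2)"
      using interior(1)[of "j - 1" "p 0"] nb_sym[OF assms] j by simp
    then show ?thesis using p_eq[of 0 "j - 1"] p_eq[of 0 "j - 1 + 2"] that by auto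
  qed
  ultimately show ?thesis by (cases "j = k") auto
qed

lemma outside_parity:
  assumes w: "w \<in> V" "w \<notin> p ` {..k}" and i: "i \<le> k"
  shows "E w (p i) \<longleftrightarrow> E w (p (i mod 2))"
proof -
  have "i mod 2 + 2 * d \<le> k \<Longrightarrow> E w (p (i mod 2 + 2 * d)) \<longleftrightarrow> E w (p (i mod 2))" for d
  proof (induction d)
    case (Suc d)
    have "w \<noteq> p j" if "j \<le> k" for j using w that by blast
    then show ?case using Suc interior(2)[of "i mod 2 + 2 * d" w] w by simp
  qed simp
  from this[of "i div 2"] show ?thesis using i by simp
qed

lemma outside_parity_cong:
  assumes "w \<in> V" "w \<notin> p ` {..k}" "i \<le> k" "j \<le> k" "even i \<longleftrightarrow> even j"
  shows "E w (p i) \<longleftrightarrow> E w (p j)"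
  using outside_parity[of w i] outside_parity[of w j] assms by (metis parity_cases)

lemma row_shift: "i < j \<Longrightarrow> j + 2 * d \<le> k \<Longrightarrow> E (p i) (p (j + 2 * d)) \<longleftrightarrow> E (p i) (p j)"
proof (induction d)
  case (Suc d)
  have "E (p i) (p (j + 2 * d)) \<longleftrightarrow> E (p i) (p (j + 2 * d + 2))"
    using interior(2)[of "j + 2 * d" "p i"] Suc.prems pV[of i] by (simp add: p_eq)
  then show ?case using Suc by simp
qed simp

lemma column_shift: "i + 2 * d < j \<Longrightarrow> j \<le> k \<Longrightarrow> E (p (i + 2 * d)) (p j) \<longleftrightarrow> E (p i) (p j)"
proof (induction d)
  case (Suc d)
  have "E (p j) (p (i + 2 * d)) \<longleftrightarrow> E (p j) (p (i + 2 * d + 2))"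
    using interior(2)[of "i + 2 * d" "p j"] Suc.prems pV[of j] by (simp add: p_eq)
  then have "E (p (i + 2 * d)) (p j) \<longleftrightarrow> E (p (i + 2 * d + 2)) (p j)"
    using p_flip[of "i + 2 * d" j] p_flip[of "i + 2 * d + 2" j] Suc.prems by simp
  then show ?case using Suc by simp
qed simp

text \<open>Both pairs are moved to a common one in steps of two. The larger index is first raised
  to \<open>t\<close>, then the smaller one lowered to its residue; in this order the two indices
  never meet, as the shift lemmas require.\<close>

lemma parity_cong:
  assumes "i < j" "j \<le> k" "i' < j'" "j' \<le> k" "even i \<longleftrightarrow> even i'" "even j \<longleftrightarrow> even j'"
  shows "E (p i) (p j) \<longleftrightarrow> E (p i') (p j')"
proof -
  define t where "t = max j j'"
  have t: "t \<le> k" "j \<le> t" "j' \<le> t" using assms unfolding t_def by auto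
  have *: "E (p a) (p b) \<longleftrightarrow> E (p (a mod 2)) (p t)"
    if "a < b" "b \<le> t" "even b \<longleftrightarrow> even t" for a b
  proof -
    have "even (t - b)" using that by auto
    then obtain d where d: "t - b = 2 * d" by (elim evenE)
    then have "t = b + 2 * d" using that by simp
    then have "E (p a) (p b) \<longleftrightarrow> E (p a) (p t)" using row_shift[of a b d] that t by simp
    moreover have "a mod 2 + 2 * (a div 2) = a" by simp
    then have "E (p a) (p t) \<longleftrightarrow> E (p (a mod 2)) (p t)"
      using column_shift[of "a mod 2" "a div 2" t] that t by simp
    ultimately show ?thesis by simp
  qed
  have "even j \<longleftrightarrow> even t" unfolding t_def using assms by (simp add: max_def)
  moreover have "i mod 2 = i' mod 2" using assms by (metis parity_cases)
  ultimately show ?thesis using *[of i j] *[of i' j'] assms t by simp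
qed

section \<open>Primality against the parity pattern: open paths and cycles\<close>

lemma not_module:
  assumes "a \<in> M" "b \<in> M" "a \<noteq> b" "v \<in> V" "v \<notin> M"
  shows "\<not> arc_module E V M"
  using arc_prime_module_eq[OF prime] assms by blast

text \<open>A source or a sink \<open>v\<close> would make \<open>V - {v}\<close> a module.\<close>

lemma not_dominating:
  assumes "v \<in> V" shows "\<exists>a \<in> V - {v}. \<exists>b \<in> V - {v}. E v a \<and> \<not> E v b"
proof (rule ccontr)
  assume no: "\<not> ?thesis"
  obtain s where s: "s \<in> V" "s \<noteq> v" "s \<noteq> v" using arc_prime_ex_other[OF prime] .
  obtain t where t: "t \<in> V" "t \<noteq> v" "t \<noteq> s" using arc_prime_ex_other[OF prime] .
  have "arc_module E V (V - {v})" unfolding arc_module_def using no by blast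
  then show False using not_module[of s "V - {v}" t v] s t assms by blast
qed

lemma card_path: "card (p ` {..k}) = k + 1"
  using card_image[OF inj] by simp

lemma path_subset: "p ` {..k} \<subseteq> V"
  using pV by auto

lemma bij_full:
  assumes "p ` {..k} = V"
  shows "bij_betw p {..<card V} V" "card V = k + 1"
proof -
  show "card V = k + 1" using card_path assms by simp
  then show "bij_betw p {..<card V} V"
    using inj assms by (simp add: bij_betw_def lessThan_Suc_atMost)
qed

text \<open>In both alternatives \<open>p 1\<close> is the only neighbour of \<open>p 0\<close>, so
  \<open>nb_single\<close> applies. For \<open>k = 1\<close> the vertices \<open>p 0\<close> and
  \<open>p k\<close> are adjacent, but \<open>p k\<close> is \<open>p 1\<close> and no cycle
  closes.\<close>

lemma end_const:
  assumes "\<not> nb (p 0) (p k) \<or> k = 1" "a \<in> V - {p 0, p 1}" "b \<in> V - {p 0, p 1}"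
  shows "E (p 1) a \<longleftrightarrow> E (p 1) b"
proof (rule nb_single)
  show "nb (p 0) (p 1)" using step[of 0] k1 by simp
  show "z = p 1" if "nb (p 0) z" for z using nb_end[OF that] assms(1) that by auto
qed (use assms in auto)

text \<open>For \<open>k = 1\<close> neither path vertex separates the vertices off the path, which
  then form a nontrivial module. For \<open>k = 2\<close> both ends force \<open>p 1\<close> to
  treat the other vertices alike, which makes it a source or a sink.\<close>

lemma path_case_k:
  assumes "\<not> nb (p 0) (p k) \<or> k = 1"
  shows "k \<ge> 3"
proof (rule ccontr)
  interpret r: critical_path E V "\<lambda>i. p (k - i)" k by (rule reversed)
  have rc: "\<not> nb (p (k - 0)) (p (k - k)) \<or> k = 1" using assms nb_sym by auto
  assume "\<not> k \<ge> 3"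
  then consider "k = 1" | "k = 2" using k1 by linarith
  then show False
  proof cases
    case 1
    have out: "E w a \<longleftrightarrow> E w b" if "w \<in> {p 0, p 1}" "a \<in> V - {p 0, p 1}" "b \<in> V - {p 0, p 1}" for w a b
      using that end_const[OF assms, of a b] r.end_const[OF rc, of a b] 1 by auto
    have m: "arc_module E V (V - {p 0, p 1})" unfolding arc_module_def
    proof (intro conjI ballI)
      fix w a b assume "w \<in> V - (V - {p 0, p 1})" "a \<in> V - {p 0, p 1}" "b \<in> V - {p 0, p 1}"
      then show "E w a \<longleftrightarrow> E w b" by (intro out) auto
    qed blast
    have "card (V - {p 0, p 1}) \<ge> 2"
      using card5 diff_card_le_card_Diff[of "{p 0, p 1}" V] by (simp add: card_insert_if split: if_splits)
    then obtain a b where "a \<in> V - {p 0, p 1}" "b \<in> V - {p 0, p 1}" "a \<noteq> b"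
      by (rule card_ge_2_ex)
    then show False using not_module[of a "V - {p 0, p 1}" b "p 0"] m pV[of 0] by blast
  next
    case 2
    have "card {p 0, p 1, p 2} \<le> 3" by (simp add: card_insert_if)
    then have "card (V - {p 0, p 1, p 2}) \<ge> 1"
      using card5 diff_card_le_card_Diff[of "{p 0, p 1, p 2}" V] by simp
    then have "V - {p 0, p 1, p 2} \<noteq> {}" using card.empty by (metis not_one_le_zero)
    then obtain w where w: "w \<in> V - {p 0, p 1, p 2}" by blast
    \<comment> \<open>One end gives constancy away from \<open>p 0\<close>, the other away from
      \<open>p 2\<close>; the vertex \<open>w\<close> off the path links the two ranges.\<close>
    have "E (p 1) a \<longleftrightarrow> E (p 1) w" if "a \<in> V - {p 1}" for a
    proof (cases "a = p 0")
      case True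
      then show ?thesis using r.end_const[OF rc, of a w] 2 w that p_eq[of 0 2] by auto
    next
      case False
      then show ?thesis using end_const[OF assms, of a w] w that by auto
    qed
    moreover have "p 1 \<in> V" using pV[of 1] 2 by simp
    ultimately show False using not_dominating[of "p 1"] by blast
  qed
qed

text \<open>The arc from \<open>p 1\<close> to \<open>p 2\<close> fixes a direction:
  \<open>p 1\<close> dominates everything but \<open>p 0\<close>, and \<open>p (k - 1)\<close> is
  dominated by everything but \<open>p k\<close>. Spread by parity, this settles every arc of the
  path except those from an even index \<open>i\<close> to a larger index \<open>j\<close> of the
  parity of \<open>k\<close>, so one bit is left.\<close>

lemma forward_end:
  assumes "\<not> nb (p 0) (p k)" "E (p 1) (p 2)"
  shows "3 \<le> k" "a \<in> V - {p 0, p 1} \<Longrightarrow> E (p 1) a"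
    "a \<in> V - {p k, p (k - 1)} \<Longrightarrow> \<not> E (p (k - 1)) a"
    "i < j \<Longrightarrow> j \<le> k \<Longrightarrow> odd i \<Longrightarrow> E (p i) (p j)"
    "i < j \<Longrightarrow> j \<le> k \<Longrightarrow> odd (k - j) \<Longrightarrow> E (p i) (p j)"
proof -
  interpret r: critical_path E V "\<lambda>i. p (k - i)" k by (rule reversed)
  have c: "\<not> nb (p 0) (p k) \<or> k = 1" and rc: "\<not> nb (p (k - 0)) (p (k - k)) \<or> k = 1"
    using assms nb_sym by auto
  show k: "3 \<le> k" by (rule path_case_k[OF c])
  show f: "E (p 1) a" if "a \<in> V - {p 0, p 1}" for a
    using end_const[OF c, of a "p 2"] that assms k pV[of 2] p_eq[of 2 0] p_eq[of 2 1] by auto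
  have "E (p 1) (p (k - 1))" using f[of "p (k - 1)"] k pV p_eq by auto
  then have b1: "\<not> E (p (k - 1)) (p 1)" using p_flip[of 1 "k - 1"] k by auto
  show b: "\<not> E (p (k - 1)) a" if "a \<in> V - {p k, p (k - 1)}" for a
    using r.end_const[OF rc, of a "p 1"] that b1 k pV[of 1] p_eq[of 1 k] p_eq[of 1 "k - 1"] by auto
  show "E (p i) (p j)" if "i < j" "j \<le> k" "odd i" for i j
  proof -
    \<comment> \<open>A representative of the parity of \<open>j\<close> beyond 1;
      \<open>3 \<le> k\<close> keeps it on the path.\<close>
    define j' where "j' = (if even j then 2 else 3 :: nat)"
    have j': "1 < j'" "j' \<le> k" "even j \<longleftrightarrow> even j'" using k unfolding j'_def by auto
    then have "E (p 1) (p j')" using f[of "p j'"] pV p_eq by auto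
    then show ?thesis using parity_cong[of i j 1 j'] that j' by simp
  qed
  show "E (p i) (p j)" if "i < j" "j \<le> k" "odd (k - j)" for i j
  proof -
    define i' where "i' = (if even i then 0 else 1 :: nat)"
    have i': "i' < k - 1" "even i \<longleftrightarrow> even i'" using k unfolding i'_def by auto
    then have "\<not> E (p (k - 1)) (p i')" using b[of "p i'"] pV p_eq by auto
    then have "E (p i') (p (k - 1))" using p_flip[of i' "k - 1"] i' by auto
    moreover have "even j \<longleftrightarrow> even (k - 1)" using that k by auto
    ultimately show ?thesis using parity_cong[of i j i' "k - 1"] that i' by simp
  qed
qed

text \<open>A vertex \<open>w\<close> off the path would be dominated by \<open>p 1\<close> and
  would dominate \<open>p (k - 1)\<close>, although 1 and \<open>k - 1\<close> have the same parity.
  The remaining bit is the arc between \<open>p 0\<close> and \<open>p 2\<close>; directed forward,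
  it would make \<open>p 0\<close> a source. This is the pattern of \<open>tour_U\<close>.\<close>

lemma path_even:
  assumes "\<not> nb (p 0) (p k)" "E (p 1) (p 2)" "even k"
  shows "p ` {..k} = V" "i < j \<Longrightarrow> j \<le> k \<Longrightarrow> E (p i) (p j) \<longleftrightarrow> \<not> (even i \<and> even j)"
proof -
  note F = forward_end[OF assms(1,2)]
  show full: "p ` {..k} = V"
  proof (rule ccontr)
    assume "p ` {..k} \<noteq> V"
    then obtain w where w: "w \<in> V" "w \<notin> p ` {..k}" using path_subset by blast
    then have w': "w \<noteq> p i" if "i \<le> k" for i using that by blast
    have "E (p 1) w" using F(2)[of w] w w'[of 0] w'[of 1] F(1) by auto
    then have "\<not> E w (p 1)" using asym[of w "p 1"] w w'[of 1] pV[of 1] F(1) by auto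
    moreover have "\<not> E (p (k - 1)) w" using F(3)[of w] w w' by auto
    then have "E w (p (k - 1))" using asym[of w "p (k - 1)"] w w'[of "k - 1"] pV[of "k - 1"] by auto
    ultimately show False using outside_parity_cong[OF w, of 1 "k - 1"] F(1) assms(3) by auto
  qed
  have "\<not> E (p 0) (p 2)"
  proof
    assume a: "E (p 0) (p 2)"
    have "E (p 0) (p j)" if "0 < j" "j \<le> k" for j
    proof (cases "even j")
      case True
      then show ?thesis using parity_cong[of 0 j 0 2] a that F(1) by simp
    next
      case False
      then show ?thesis using F(5)[of 0 j] that assms(3) by auto
    qed
    then have "E (p 0) x" if "x \<in> V - {p 0}" for x using that full by (auto simp: image_iff) (metis gr0I)
    then show False using not_dominating[of "p 0"] pV[of 0] by blast
  qed
  then show "E (p i) (p j) \<longleftrightarrow> \<not> (even i \<and> even j)" if "i < j" "j \<le> k"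
    using F(4)[of i j] F(5)[of i j] that assms(3) parity_cong[of i j 0 2] F(1) by auto
qed

text \<open>Now 1 and \<open>k - 1\<close> have different parities, so the arcs of a vertex off the
  path are prescribed rather than contradictory. All such vertices look alike from the path, so
  primality allows at most one, and there is one because \<open>k + 1\<close> is even while
  \<open>card V\<close> is odd. The remaining bit is the arc between \<open>p 0\<close> and
  \<open>p 1\<close>; directed backward, it would let the odd-indexed vertices dominate all others.
  With the extra vertex placed last this is the pattern of \<open>tour_W\<close>.\<close>

lemma path_odd:
  assumes "\<not> nb (p 0) (p k)" "E (p 1) (p 2)" "odd k"
  shows "\<exists>w. w \<notin> p ` {..k} \<and> V = insert w (p ` {..k}) \<and> (\<forall>i \<le> k. E (p i) w \<longleftrightarrow> odd i)"
    and "i < j \<Longrightarrow> j \<le> k \<Longrightarrow> E (p i) (p j)"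
proof -
  note F = forward_end[OF assms(1,2)]
  let ?K = "p ` {..k}"
  have out: "E (p i) w \<longleftrightarrow> odd i" if w: "w \<in> V" "w \<notin> ?K" and i: "i \<le> k" for w i
  proof -
    have w': "w \<noteq> p i" if "i \<le> k" for i using w that by blast
    have "E (p 1) w" using F(2)[of w] w w'[of 0] w'[of 1] F(1) by auto
    then have a: "\<not> E w (p 1)" using asym[of w "p 1"] w w'[of 1] pV[of 1] F(1) by auto
    have "\<not> E (p (k - 1)) w" using F(3)[of w] w w' by auto
    then have b: "E w (p (k - 1))" using asym[of w "p (k - 1)"] w w'[of "k - 1"] pV[of "k - 1"] by auto
    have "E w (p i) \<longleftrightarrow> even i"
      using outside_parity_cong[OF w i, of 1] outside_parity_cong[OF w i, of "k - 1"] a b F(1) assms(3) by auto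
    then show ?thesis using asym[of w "p i"] w w'[OF i] pV[OF i] by auto
  qed
  have m: "arc_module E V (V - ?K)" unfolding arc_module_def
  proof (intro conjI ballI)
    fix x a b assume "x \<in> V - (V - ?K)" "a \<in> V - ?K" "b \<in> V - ?K"
    then show "E x a \<longleftrightarrow> E x b" using out[of a] out[of b] by auto
  qed blast
  have "card V \<noteq> k + 1" using odd_card_ex_nb assms(3) by auto
  then have "?K \<noteq> V" using card_path by auto
  then obtain w where w: "w \<in> V" "w \<notin> ?K" using path_subset by blast
  have "x = w" if "x \<in> V - ?K" for x
    using not_module[of x "V - ?K" w "p 0"] m w that pV[of 0] by blast
  then have Vw: "V = insert w ?K" using w path_subset by blast
  then show "\<exists>w. w \<notin> ?K \<and> V = insert w ?K \<and> (\<forall>i \<le> k. E (p i) w \<longleftrightarrow> odd i)"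
    using w out by blast
  have e01: "E (p 0) (p 1)"
  proof (rule ccontr)
    assume s: "\<not> E (p 0) (p 1)"
    let ?A = "p ` {i. i \<le> k \<and> odd i}"
    have dom: "E (p i) a" if h: "i \<le> k" "odd i" "a \<in> V - ?A" for i a
    proof (cases "a = w")
      case True
      then show ?thesis using out[OF w h(1)] h(2) by simp
    next
      case False
      have "a \<in> V" using h(3) by simp
      then have "a \<in> insert w ?K" using Vw by simp
      then obtain j where j: "j \<le> k" "a = p j" using False by blast
      then have ev: "even j" using h(3) by blast
      then consider "i < j" | "j < i" using h by (cases i j rule: linorder_cases) auto
      then show ?thesis
      proof cases
        case 1
        then show ?thesis using F(4) j h by blast
      next
        case 2
        then have "\<not> E (p j) (p i)" using parity_cong[of j i 0 1] s j h ev F(1) by auto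
        then show ?thesis using p_flip[of i j] 2 j h by auto
      qed
    qed
    have "arc_module E V (V - ?A)" unfolding arc_module_def
    proof (intro conjI ballI)
      fix x a b assume x: "x \<in> V - (V - ?A)" and ab: "a \<in> V - ?A" "b \<in> V - ?A"
      have "x \<in> ?A" using x by blast
      then obtain i where "i \<le> k" "odd i" "x = p i" by blast
      then show "E x a \<longleftrightarrow> E x b" using dom[of i a] dom[of i b] ab by simp
    qed blast
    moreover have "w \<in> V - ?A" "p 0 \<in> V - ?A" using w pV[of 0] p_eq by auto
    moreover have "w \<noteq> p 0" "p 1 \<in> V" "p 1 \<notin> V - ?A" using w pV[of 1] F(1) by auto
    ultimately show False using not_module[of w "V - ?A" "p 0" "p 1"] by blast
  qed
  show "E (p i) (p j)" if "i < j" "j \<le> k" for i j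
  proof (cases "odd i \<or> even j")
    case True
    then show ?thesis using F(4)[of i j] F(5)[of i j] that assms(3) by auto
  next
    case False
    then show ?thesis using parity_cong[of i j 0 1] e01 that F(1) by simp
  qed
qed

text \<open>The closing edge yields two more twin relations, around \<open>p 0\<close> and around
  \<open>p k\<close>. If \<open>k\<close> is odd, steps of two around the cycle preserve parity and
  the even-indexed vertices form a module. If \<open>k\<close> is even, they reach every index, so
  no vertex off the path separates the path, which is therefore all of \<open>V\<close>. The same
  relations then express all four bits through one.\<close>

lemma cycle:
  assumes cyc: "nb (p 0) (p k)" "k \<noteq> 1"
  shows "p ` {..k} = V" "even k"
    "i < j \<Longrightarrow> j \<le> k \<Longrightarrow> E (p i) (p j) \<longleftrightarrow> ((even i \<longleftrightarrow> even j) \<longleftrightarrow> E (p 0) (p 2))"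
proof -
  have k2: "k \<ge> 2" using cyc k1 by linarith
  have s0: "E w (p 1) \<longleftrightarrow> E w (p k)" if "w \<in> V" "w \<notin> {p 0, p 1, p k}" for w
    using nb_double(2)[of "p 0" "p 1" "p k" w] step[of 0] cyc k2 p_eq that by auto
  have sk: "E w (p (k - 1)) \<longleftrightarrow> E w (p 0)" if "w \<in> V" "w \<notin> {p k, p (k - 1), p 0}" for w
    using nb_double(2)[of "p k" "p (k - 1)" "p 0" w] nb_sym[OF step[of "k - 1"]] nb_sym[OF cyc(1)] k2 p_eq that by auto
  show ev: "even k"
  proof (rule ccontr)
    assume od: "odd k"
    then have k3: "k \<ge> 3" using k2 by (cases "k = 2") auto
    let ?A = "p ` {i. i \<le> k \<and> even i}"
    have *: "E w (p i) \<longleftrightarrow> E w (p 0)" if h: "w \<in> V - ?A" "i \<le> k" "even i" for w i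
    proof (cases "w \<in> p ` {..k}")
      case False
      then show ?thesis using outside_parity_cong[of w i 0] h by auto
    next
      case True
      then obtain j where j: "j \<le> k" "w = p j" by blast
      then have oj: "odd j" using h(1) by blast
      have r: "E (p 1) (p (k - 1)) \<longleftrightarrow> E (p 1) (p 0)" using sk[of "p 1"] pV[of 1] k3 p_eq by auto
      show ?thesis
      proof (cases "i < j")
        case True
        then have "E (p i) (p j) \<longleftrightarrow> E (p 0) (p j)" using parity_cong[of i j 0 j] h j oj by auto
        then show ?thesis using p_flip[of i j] p_flip[of 0 j] True h j oj by auto
      next
        case False
        then have lt: "j < i" using j h oj by (cases i j rule: linorder_cases) auto
        have "E (p j) (p i) \<longleftrightarrow> E (p 1) (p (k - 1))" using parity_cong[of j i 1 "k - 1"] lt h j oj k3 od by auto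
        moreover have "E (p 0) (p 1) \<longleftrightarrow> E (p 0) (p j)" using parity_cong[of 0 1 0 j] lt j oj k3 h by (cases j) auto
        moreover have "E (p 1) (p 0) \<longleftrightarrow> E (p j) (p 0)"
          using calculation(2) p_flip[of 0 1] p_flip[of 0 j] lt j oj k3 by (cases "j = 0") auto
        ultimately show ?thesis using r j by simp
      qed
    qed
    have "arc_module E V ?A" unfolding arc_module_def
    proof (intro conjI ballI)
      fix w a b assume w: "w \<in> V - ?A" and ab: "a \<in> ?A" "b \<in> ?A"
      then obtain i j where "i \<le> k" "even i" "a = p i" "j \<le> k" "even j" "b = p j" by blast
      then show "E w a \<longleftrightarrow> E w b" using *[OF w, of i] *[OF w, of j] by simp
    qed (use pV in auto)
    moreover have "p 0 \<in> ?A" "p 2 \<in> ?A" "p 0 \<noteq> p 2" "p 1 \<in> V" "p 1 \<notin> ?A"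
      using k3 pV[of 1] p_eq by (auto simp: image_iff) 
    ultimately show False using not_module[of "p 0" ?A "p 2" "p 1"] by blast
  qed
  have m: "arc_module E V (p ` {..k})" unfolding arc_module_def
  proof (intro conjI ballI)
    fix w a b assume w: "w \<in> V - p ` {..k}" and ab: "a \<in> p ` {..k}" "b \<in> p ` {..k}"
    have "p i \<noteq> w" if "i \<le> k" for i using w that by blast
    then have "E w (p 1) \<longleftrightarrow> E w (p k)" using s0[of w] w k1 by blast
    moreover have "E w (p k) \<longleftrightarrow> E w (p 0)" using outside_parity_cong[of w k 0] w ev by auto
    ultimately have "E w (p 1) \<longleftrightarrow> E w (p 0)" by blast
    then have "E w (p i) \<longleftrightarrow> E w (p 0)" if "i \<le> k" for i
      using outside_parity[of w i] w that by (cases "even i") (simp_all add: odd_iff_mod_2_eq_one)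
    then show "E w a \<longleftrightarrow> E w b" using ab by auto
  qed (use path_subset in blast)
  then show full: "p ` {..k} = V"
    using arc_prime_module_eq[OF prime m, of "p 0" "p 1"] p_eq[of 0 1] k1 by auto
  \<comment> \<open>The size bound makes \<open>k - 1\<close> an odd index that is at least 3, as
    the comparisons below require.\<close>
  have k4: "k \<ge> 4" using bij_full[OF full] card5 by simp
  have "E (p 1) (p (k - 1)) \<longleftrightarrow> E (p 1) (p 0)" using sk[of "p 1"] pV[of 1] k4 p_eq by auto
  moreover have "E (p 1) (p 3) \<longleftrightarrow> E (p 1) (p (k - 1))" using parity_cong[of 1 3 1 "k - 1"] ev k4 by auto
  moreover have "E (p 1) (p 0) \<longleftrightarrow> \<not> E (p 0) (p 1)" using p_flip[of 0 1] k4 by auto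
  ultimately have a1: "E (p 1) (p 3) \<longleftrightarrow> \<not> E (p 0) (p 1)" by blast
  have "E (p 2) (p (k - 1)) \<longleftrightarrow> E (p 2) (p 0)" using sk[of "p 2"] pV[of 2] k4 p_eq ev by auto
  moreover have "E (p 0) (p 1) \<longleftrightarrow> E (p 2) (p (k - 1))" using parity_cong[of 0 1 2 "k - 1"] ev k4 by auto
  moreover have "E (p 2) (p 0) \<longleftrightarrow> \<not> E (p 0) (p 2)" using p_flip[of 0 2] k4 by auto
  ultimately have a2: "E (p 0) (p 1) \<longleftrightarrow> \<not> E (p 0) (p 2)" by blast
  have "E (p 2) (p 1) \<longleftrightarrow> E (p 2) (p k)" using s0[of "p 2"] pV[of 2] k4 p_eq by auto
  moreover have "E (p 0) (p 2) \<longleftrightarrow> E (p 2) (p k)" using parity_cong[of 0 2 2 k] ev k4 by auto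
  moreover have "E (p 2) (p 1) \<longleftrightarrow> \<not> E (p 1) (p 2)" using p_flip[of 1 2] k4 by auto
  ultimately have a3: "E (p 1) (p 2) \<longleftrightarrow> \<not> E (p 0) (p 2)" by blast
  show "E (p i) (p j) \<longleftrightarrow> ((even i \<longleftrightarrow> even j) \<longleftrightarrow> E (p 0) (p 2))" if "i < j" "j \<le> k"
  proof -
    consider "even i" "even j" | "even i" "odd j" | "odd i" "even j" | "odd i" "odd j" by blast
    then show ?thesis
    proof cases
      case 1
      then show ?thesis using parity_cong[of i j 0 2] that k4 by simp
    next
      case 2
      then show ?thesis using parity_cong[of i j 0 1] a2 that k4 by simp
    next
      case 3
      then show ?thesis using parity_cong[of i j 1 2] a3 that k4 by simp
    next
      case 4
      then show ?thesis using parity_cong[of i j 1 3] a1 a2 that k4 by simp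
    qed
  qed
qed

end

section \<open>Existence of a longest path and the three normal forms\<close>

context critical_tournament
begin

text \<open>Lengths are bounded by \<open>card V\<close>, so a greatest \<open>k\<close> exists. A
  neighbour of the first vertex off the path could be prepended; the last vertex is handled by
  reversing.\<close>

lemma ex_critical_path: "\<exists>p k. critical_path E V p k"
proof -
  define is_path where "is_path p k \<longleftrightarrow> inj_on p {..k} \<and> (\<forall>i<k. nb (p i) (p (Suc i)))" for p k
  obtain x y where xy: "nb x y" using odd_card_ex_nb by blast
  let ?P = "\<lambda>k. 1 \<le> k \<and> (\<exists>p. is_path p k)"
  have "x \<noteq> y" using xy unfolding nb_def by blast
  then have "is_path (\<lambda>i. if i = 0 then x else y) 1"
    using xy unfolding is_path_def by (auto simp: inj_on_def)
  then have P1: "?P 1" by blast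
  have bound: "k < card V" if "1 \<le> k" "is_path p k" for p k
  proof -
    have "p i \<in> V" if "i \<le> k" for i
    proof (cases i)
      case 0
      then show ?thesis using \<open>is_path p k\<close> \<open>1 \<le> k\<close> unfolding is_path_def nb_def by auto
    next
      case (Suc j)
      then show ?thesis using \<open>is_path p k\<close> \<open>i \<le> k\<close> unfolding is_path_def nb_def by auto
    qed
    then have "card (p ` {..k}) \<le> card V" using fin by (intro card_mono) auto
    then show ?thesis using that card_image[of p "{..k}"] unfolding is_path_def by simp
  qed
  then have "\<forall>k. ?P k \<longrightarrow> k < card V" by blast
  from ex_has_greatest_nat[of ?P 1 "\<lambda>k. k", OF P1 this]
  obtain k p where k: "1 \<le> k" "is_path p k" and mx: "\<And>k' p. 1 \<le> k' \<Longrightarrow> is_path p k' \<Longrightarrow> k' \<le> k" by blast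
  have pre: "z \<in> p ` {..k}" if "is_path p k" "nb (p 0) z" for p z
  proof (rule ccontr)
    assume z: "z \<notin> p ` {..k}"
    define q where "q i = (case i of 0 \<Rightarrow> z | Suc j \<Rightarrow> p j)" for i
    have "is_path q (Suc k)" unfolding is_path_def
    proof
      have "p j \<noteq> z" if "j \<le> k" for j using z that by blast
      then show "inj_on q {..Suc k}" using \<open>is_path p k\<close>
        unfolding is_path_def by (auto simp: inj_on_def q_def split: nat.splits)
      show "\<forall>i<Suc k. nb (q i) (q (Suc i))"
        using that nb_sym unfolding is_path_def q_def by (auto split: nat.splits)
    qed
    then show False using mx[of "Suc k" q] by simp
  qed
  have rev: "is_path (\<lambda>i. p (k - i)) k" unfolding is_path_def
  proof (intro conjI allI impI)
    show "inj_on (\<lambda>i. p (k - i)) {..k}"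
    proof (rule inj_onI)
      fix i j assume "i \<in> {..k}" "j \<in> {..k}" "p (k - i) = p (k - j)"
      then show "i = j" using k(2) inj_onD[of p "{..k}" "k - i" "k - j"] unfolding is_path_def by auto
    qed
    fix i assume "i < k"
    then have "nb (p (k - Suc i)) (p (Suc (k - Suc i)))" using k(2) unfolding is_path_def by simp
    then show "nb (p (k - i)) (p (k - Suc i))" using nb_sym \<open>i < k\<close> by (simp add: Suc_diff_Suc)
  qed
  have "critical_path E V p k"
  proof unfold_locales
    show "z \<in> p ` {..k}" if "nb (p 0) z" for z using pre k that by blast
    show "z \<in> p ` {..k}" if "nb (p k) z" for z
      using pre[OF rev, of z] that by auto
  qed (use k in \<open>auto simp: is_path_def\<close>)
  then show ?thesis by blast
qed

text \<open>What remains after the case lemmas is to choose the direction of the path, so that the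
  arcs match the patterns exactly and not only up to reversal.\<close>

lemma classification:
  obtains q where "bij_betw q {..<card V} V"
    "(\<forall>i j. i < j \<longrightarrow> j < card V \<longrightarrow> (E (q i) (q j) \<longleftrightarrow> (even i \<longleftrightarrow> even j))) \<or>
     (\<forall>i j. i < j \<longrightarrow> j < card V \<longrightarrow> (E (q i) (q j) \<longleftrightarrow> \<not> (even i \<and> even j))) \<or>
     (\<forall>i j. i < j \<longrightarrow> j < card V \<longrightarrow> (E (q i) (q j) \<longleftrightarrow> \<not> (j = card V - 1 \<and> even i)))"
proof -
  note found = that
  obtain p k where cp: "critical_path E V p k" using ex_critical_path by blast
  show thesis
  proof (cases "critical_tournament.nb E V (p 0) (p k) \<and> k \<noteq> 1")
    case True
    then have cyc: "nb (p 0) (p k)" "k \<noteq> 1" by auto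
    interpret critical_path E V p k by (rule cp)
    interpret r: critical_path E V "\<lambda>i. p (k - i)" k by (rule reversed)
    note C = cycle[OF cyc]
    show thesis
    proof (cases "E (p 0) (p 2)")
      case True
      then show thesis using that[of p] bij_full[OF C(1)] C(3) by simp
    next
      case False
      have "nb (p (k - 0)) (p (k - k))" using cyc nb_sym by simp
      note R = r.cycle[OF this cyc(2)]
      \<comment> \<open>As \<open>k\<close> is even, reversing the path keeps the parities and
        exchanges the order of the indices, so it negates the pattern.\<close>
      have "E (p (k - i)) (p (k - j)) \<longleftrightarrow> (even i \<longleftrightarrow> even j)" if "i < j" "j \<le> k" for i j
      proof -
        have "E (p (k - j)) (p (k - i)) \<longleftrightarrow> \<not> (even (k - j) \<longleftrightarrow> even (k - i))"
          using C(3)[of "k - j" "k - i"] False that by simp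
        moreover have "even (k - j) \<longleftrightarrow> even j" "even (k - i) \<longleftrightarrow> even i" using C(2) that by auto
        ultimately show ?thesis using p_flip[of "k - i" "k - j"] that by auto
      qed
      then show thesis using that[of "\<lambda>i. p (k - i)"] r.bij_full[OF R(1)] by simp
    qed
  next
    case False
    \<comment> \<open>Stated for an arbitrary path \<open>q\<close> because it is applied to
      \<open>p\<close> or to its reversal, whichever has the forward arc at its start.\<close>
    have main: thesis if q: "critical_path E V q k" and f: "E (q 1) (q 2)" and e: "\<not> nb (q 0) (q k)" for q
    proof -
      interpret critical_path E V q k by (rule q)
      show thesis
      proof (cases "even k")
        case True
        note P = path_even[OF e f True]
        show thesis using found[of q] bij_full[OF P(1)] P(2) by simp
      next
        case False
        note P = path_odd[OF e f False]
        obtain w where w: "w \<notin> q ` {..k}" "V = insert w (q ` {..k})" "\<And>i. i \<le> k \<Longrightarrow> E (q i) w \<longleftrightarrow> odd i"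
          using P(1) by blast
        \<comment> \<open>The vertex off the path takes the last index \<open>k + 1\<close>, that is
          \<open>card V - 1\<close>; it receives arcs exactly from the odd indices.\<close>
        define q' where "q' = q(Suc k := w)"
        have "card V = Suc (card (q ` {..k}))" using w(1,2) by simp
        then have cV: "card V = k + 2" using card_path by simp
        have "inj_on q' {..Suc k}" using inj w(1) unfolding q'_def
          by (auto simp: inj_on_def le_Suc_eq)
        moreover have "q' ` {..Suc k} = V"
          using w(2) unfolding q'_def by (auto simp: le_Suc_eq image_iff)
        ultimately have "bij_betw q' {..<card V} V" 
          using cV by (simp add: bij_betw_def lessThan_Suc_atMost)
        moreover have "E (q' i) (q' j) \<longleftrightarrow> \<not> (j = card V - 1 \<and> even i)" if "i < j" "j < card V" for i j
          using that cV w(3)[of i] P(2)[of i j] unfolding q'_def by (cases "j = Suc k") auto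
        ultimately show thesis using found[of q'] by blast
      qed
    qed
    interpret critical_path E V p k by (rule cp)
    interpret r: critical_path E V "\<lambda>i. p (k - i)" k by (rule reversed)
    have c: "\<not> nb (p 0) (p k) \<or> k = 1" using False by blast
    have k: "3 \<le> k" by (rule path_case_k[OF c])
    have e: "\<not> nb (p 0) (p k)" using c k by auto
    show thesis
    proof (cases "E (p 1) (p 2)")
      case True
      then show thesis using main cp e by blast
    next
      case f: False
      have er: "\<not> nb (p (k - 0)) (p (k - k))" using e nb_sym by auto
      \<comment> \<open>By \<open>end_const\<close>, \<open>p 1\<close> treats \<open>p 2\<close>
        and \<open>p (k - 1)\<close> alike, and \<open>p (k - 1)\<close> treats \<open>p 1\<close>
        and \<open>p (k - 2)\<close> alike. So the backward arc at the start becomes a forward arc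
        at the start of the reversed path.\<close>
      have "\<not> E (p 1) (p (k - 1))"
        using end_const[OF c, of "p 2" "p (k - 1)"] f k pV p_eq by auto
      then have "E (p (k - 1)) (p 1)" using p_flip[of 1 "k - 1"] k by auto
      moreover have "k - 1 \<noteq> 1" "k - 2 \<noteq> k" "k - 2 \<noteq> k - 1" using k by auto
      then have "E (p (k - 1)) (p 1) \<longleftrightarrow> E (p (k - 1)) (p (k - 2))"
        using r.end_const[of "p 1" "p (k - 2)"] er k pV p_eq by auto
      ultimately show thesis using main[OF reversed] er by blast
    qed
  qed
qed

end

section \<open>The hypergraph of 3-cycles\<close>

text \<open>Edges are given by cyclic triples of arcs instead of digraph isomorphisms, for an
  arbitrary relation. In a tournament the three vertices of such a triple are automatically
  distinct.\<close>

definition cycle_hypergraph :: "('a \<Rightarrow> 'a \<Rightarrow> bool) \<Rightarrow> 'a set \<Rightarrow> 'a hypergraph" where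
  "cycle_hypergraph E V = \<lparr>hverts = V,
     hedges = {{a, b, c} |a b c. a \<in> V \<and> b \<in> V \<and> c \<in> V \<and> E a b \<and> E b c \<and> E c a}\<rparr>"

lemma hverts_cycle_hypergraph [simp]: "hverts (cycle_hypergraph E V) = V"
  unfolding cycle_hypergraph_def by simp

lemma hyper_del_cycle_hypergraph:
  "hyper_del (cycle_hypergraph E V) v = cycle_hypergraph E (V - {v})"
  unfolding hyper_del_def hyper_induced_def cycle_hypergraph_def by auto

lemma cycle_edgeI:
  "a \<in> V \<Longrightarrow> b \<in> V \<Longrightarrow> c \<in> V \<Longrightarrow> E a b \<Longrightarrow> E b c \<Longrightarrow> E c a \<Longrightarrow>
    {a, b, c} \<in> hedges (cycle_hypergraph E V)"
  unfolding cycle_hypergraph_def by auto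

lemma hyper_moduleD:
  assumes "hyper_module H M" "e \<in> hedges H" "e \<inter> M \<noteq> {}" "e - M \<noteq> {}"
  obtains m where "m \<in> M" "e \<inter> M = {m}" "\<And>n. n \<in> M \<Longrightarrow> (e - {m}) \<union> {n} \<in> hedges H"
  using assms unfolding hyper_module_def by meson

lemma trivial_module_iff:
  assumes "M \<subseteq> hverts H"
  shows "trivial_module H M \<longleftrightarrow> M = {} \<or> M = hverts H \<or> (\<exists>v. M = {v})"
  using assms unfolding trivial_module_def by auto

context arc_tournament
begin

lemma cycle_distinct:
  "a \<in> V \<Longrightarrow> b \<in> V \<Longrightarrow> c \<in> V \<Longrightarrow> E a b \<Longrightarrow> E b c \<Longrightarrow> E c a \<Longrightarrow> a \<noteq> b \<and> b \<noteq> c \<and> a \<noteq> c"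
  using irrefl asym by blast

text \<open>A triple of a tournament is a 3-cycle in at most one of its two rotations, and any one
  arc decides which.\<close>

lemma cycle_edgeD:
  assumes "{a, b, c} \<in> hedges (cycle_hypergraph E V)" "E a b"
  shows "E b c \<and> E c a"
proof -
  obtain x y z where xyz: "{a, b, c} = {x, y, z}" "x \<in> V" "y \<in> V" "z \<in> V" "E x y" "E y z" "E z x"
    using assms(1) unfolding cycle_hypergraph_def by auto
  have d: "x \<noteq> y" "y \<noteq> z" "x \<noteq> z" using cycle_distinct xyz by blast+
  have n: "\<not> E y x" "\<not> E z y" "\<not> E x z" "\<not> E x x" "\<not> E y y" "\<not> E z z"
    using asym[of x y] asym[of y z] asym[of z x] irrefl xyz d by auto
  have "a \<in> {x, y, z}" "b \<in> {x, y, z}" "c \<in> {x, y, z}" using xyz(1) by auto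
  moreover have "x \<in> {a, b, c}" "y \<in> {a, b, c}" "z \<in> {a, b, c}" using xyz(1) by auto
  ultimately show ?thesis using assms(2) xyz(5-7) n d by auto
qed

text \<open>A 3-cycle not inside \<open>M\<close> meets \<open>M\<close> in at most one vertex,
  since the third vertex of the cycle separates any two of them. That one vertex can be exchanged
  within \<open>M\<close>, as the other two do not distinguish it.\<close>

lemma arc_module_imp_hyper_module:
  assumes M: "arc_module E V M"
  shows "hyper_module (cycle_hypergraph E V) M"
proof -
  have MV: "M \<subseteq> V" using M unfolding arc_module_def by blast
  \<comment> \<open>The vertex in \<open>M\<close> is named first; the general case follows by
    rotating the cycle.\<close>
  have one: "\<exists>m \<in> M. {a, b, c} \<inter> M = {m} \<and>
      (\<forall>n \<in> M. ({a, b, c} - {m}) \<union> {n} \<in> hedges (cycle_hypergraph E V))"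
    if abc: "a \<in> V" "b \<in> V" "c \<in> V" "E a b" "E b c" "E c a" and a: "a \<in> M" and out: "\<not> {a, b, c} \<subseteq> M" for a b c
  proof -
    have d: "a \<noteq> b" "b \<noteq> c" "a \<noteq> c" using cycle_distinct abc by blast+
    have n: "\<not> E b a" "\<not> E c b" "\<not> E a c"
      using asym[of a b] asym[of b c] asym[of c a] abc d by auto
    have b: "b \<notin> M"
    proof
      assume "b \<in> M"
      then have "c \<notin> M" using a out by blast
      then show False using arc_moduleD[OF M, of c a b] \<open>b \<in> M\<close> a abc n by blast
    qed
    have c: "c \<notin> M"
      using arc_moduleD[OF M, of b a c] b a abc n by blast
    have "({a, b, c} - {a}) \<union> {n} \<in> hedges (cycle_hypergraph E V)" if n: "n \<in> M" for n
    proof -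
      have nV: "n \<in> V" "n \<noteq> b" "n \<noteq> c" using n MV b c by auto
      have "E c n" using arc_moduleD[OF M, of c a n] abc c a n by blast
      moreover have "\<not> E b n" using arc_moduleD[OF M, of b a n] abc b a n \<open>\<not> E b a\<close> by blast
      then have "E n b" using asym[of n b] nV abc by blast
      ultimately have "{n, b, c} \<in> hedges (cycle_hypergraph E V)" using cycle_edgeI[of _ V _ _ E] nV abc by blast
      moreover have "({a, b, c} - {a}) \<union> {n} = {n, b, c}" using d by auto
      ultimately show ?thesis by simp
    qed
    moreover have "{a, b, c} \<inter> M = {a}" using a b c by blast
    ultimately show ?thesis using a by blast
  qed
  show ?thesis unfolding hyper_module_def
  proof (intro conjI ballI impI)
    fix e assume "e \<in> hedges (cycle_hypergraph E V)" and i: "e \<inter> M \<noteq> {} \<and> e - M \<noteq> {}"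
    then obtain a b c where abc: "e = {a, b, c}" "a \<in> V" "b \<in> V" "c \<in> V" "E a b" "E b c" "E c a"
      unfolding cycle_hypergraph_def by auto
    have r: "{b, c, a} = {a, b, c}" "{c, a, b} = {a, b, c}" by auto
    have "a \<in> M \<or> b \<in> M \<or> c \<in> M" using i abc(1) by auto
    then show "\<exists>m \<in> M. e \<inter> M = {m} \<and> (\<forall>n \<in> M. (e - {m}) \<union> {n} \<in> hedges (cycle_hypergraph E V))"
    proof (elim disjE)
      assume "a \<in> M"
      then show ?thesis using one[of a b c] abc i by auto
    next
      assume "b \<in> M"
      then show ?thesis using one[of b c a] abc i unfolding r by auto
    next
      assume "c \<in> M"
      then show ?thesis using one[of c a b] abc i unfolding r by auto
    qed
  qed (use MV in simp)
qed

lemma hyper_prime_imp_arc_prime: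
  assumes "hyper_prime (cycle_hypergraph E V)"
  shows "arc_prime E V"
  unfolding arc_prime_def
proof (intro conjI allI impI)
  show "card V \<ge> 3" using assms unfolding hyper_prime_def by simp
  fix M assume M: "arc_module E V M"
  then have "trivial_module (cycle_hypergraph E V) M"
    using arc_module_imp_hyper_module assms unfolding hyper_prime_def by blast
  moreover have "M \<subseteq> V" using M unfolding arc_module_def by blast
  ultimately show "M = {} \<or> M = V \<or> (\<exists>v. M = {v})" by (simp add: trivial_module_iff)
qed

text \<open>The in- and out-neighbours in \<open>M\<close> of a vertex outside a module \<open>M\<close> of \<open>C\<^sub>3(T)\<close> are separated
  by arcs from the former to the latter, so the sets of in-neighbours form a chain. For
  prime \<open>T\<close>, none of these sets is empty or all of \<open>M\<close>, and the smallest one would dominate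
  the rest of \<open>T\<close>.\<close>

lemma hyper_module_split:
  assumes M: "hyper_module (cycle_hypergraph E V) M" and x: "x \<in> V - M"
    and ab: "a \<in> M" "b \<in> M" "E a x" "E x b"
  shows "E a b"
proof (rule ccontr)
  assume n: "\<not> E a b"
  have V: "a \<in> V" "b \<in> V" "x \<in> V" using M ab x unfolding hyper_module_def by auto
  have "a \<noteq> b" using asym[of a x] ab x V by auto
  then have "E b a" using n asym[of a b] V by blast
  then have "{a, x, b} \<in> hedges (cycle_hypergraph E V)" using cycle_edgeI[of _ V _ _ E] V ab by blast
  moreover have "{a, x, b} \<inter> M \<noteq> {}" "{a, x, b} - M \<noteq> {}" using ab x by auto
  ultimately obtain m where "{a, x, b} \<inter> M = {m}" using hyper_moduleD[OF M] by metis
  moreover have "a \<in> {a, x, b} \<inter> M" "b \<in> {a, x, b} \<inter> M" using ab by auto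
  ultimately show False using \<open>a \<noteq> b\<close> by auto
qed

text \<open>The edge meets \<open>M\<close> only in \<open>m\<close>, so the module condition makes
  \<open>{x, y, n}\<close> an edge, and the arc from \<open>x\<close> to \<open>y\<close> fixes its
  rotation.\<close>

lemma hyper_module_replace:
  assumes M: "hyper_module (cycle_hypergraph E V) M" and x: "x \<in> V - M" and y: "y \<in> V - M"
    and m: "m \<in> M" "E m x" "E x y" "E y m" and n: "n \<in> M"
  shows "E n x \<and> E y n"
proof -
  have V: "m \<in> V" "n \<in> V" "x \<in> V" "y \<in> V" using M m x y n unfolding hyper_module_def by auto
  have "{m, x, y} \<in> hedges (cycle_hypergraph E V)" using cycle_edgeI[of _ V _ _ E] V m by blast
  moreover have "{m, x, y} \<inter> M \<noteq> {}" "{m, x, y} - M \<noteq> {}" using m x by auto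
  ultimately obtain m' where m': "{m, x, y} \<inter> M = {m'}"
    "\<And>n. n \<in> M \<Longrightarrow> ({m, x, y} - {m'}) \<union> {n} \<in> hedges (cycle_hypergraph E V)"
    using hyper_moduleD[OF M] by metis
  have "m' = m" using m'(1) m(1) by auto
  moreover have "({m, x, y} - {m}) \<union> {n} = {x, y, n}" using m x y by auto
  ultimately have "{x, y, n} \<in> hedges (cycle_hypergraph E V)" using m'(2) n by metis
  then show ?thesis using cycle_edgeD m by blast
qed

text \<open>Let \<open>N\<close> be \<open>M\<close> together with the vertices that have both in-
  and out-neighbours in \<open>M\<close>. A vertex \<open>z\<close> outside \<open>N\<close> is
  uniform on \<open>M\<close>; if it treated some \<open>r\<close> in \<open>N\<close> differently,
  then \<open>r\<close> would be mixed and form a 3-cycle with \<open>z\<close> and a vertex of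
  \<open>M\<close>, and exchanging that vertex would turn an arc at \<open>r\<close> around. So
  \<open>N\<close> is a module of the tournament, and primality gives \<open>N = V\<close>.\<close>

lemma hyper_module_mixed:
  assumes P: "arc_prime E V" and M: "hyper_module (cycle_hypergraph E V) M"
    and two: "a \<in> M" "b \<in> M" "a \<noteq> b" and x: "x \<in> V - M"
  shows "\<exists>m \<in> M. \<exists>n \<in> M. E m x \<and> E x n"
proof -
  have MV: "M \<subseteq> V" using M unfolding hyper_module_def by simp
  define N where "N = {y \<in> V. y \<in> M \<or> (\<exists>m \<in> M. \<exists>n \<in> M. E m y \<and> E y n)}"
  have up: "E z r" if z: "z \<in> V - N" "E z a" and r: "r \<in> N" for z r
  proof (rule ccontr)
    assume nz: "\<not> E z r"
    have zM: "z \<in> V - M" using z unfolding N_def by blast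
    have all: "E z m" if m: "m \<in> M" for m
      using z(1) m two(1) z(2) zM asym[of z m] MV unfolding N_def by blast
    then have "r \<notin> M" using nz by blast
    then obtain m n where mn: "m \<in> M" "n \<in> M" "E m r" "E r n" and rV: "r \<in> V - M"
      using r unfolding N_def by blast
    have "r \<noteq> z" using r z by blast
    then have "E r z" using nz asym[of z r] rV zM by blast
    then have "E n r" using hyper_module_replace[OF M rV zM mn(1) mn(3) _ all[OF mn(1)] mn(2)] by blast
    then show False using asym[of n r] mn rV MV by blast
  qed
  have down: "\<not> E z r" if z: "z \<in> V - N" "\<not> E z a" and r: "r \<in> N" for z r
  proof
    assume nz: "E z r"
    have zM: "z \<in> V - M" using z unfolding N_def by blast
    have az: "E a z" using z(2) asym[of z a] two zM MV by blast
    have all: "\<not> E z m" if m: "m \<in> M" for m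
      using z(1) m two(1) az zM unfolding N_def by blast
    then have all': "E m z" if m: "m \<in> M" for m using m asym[of z m] zM MV by blast
    have "r \<notin> M" using nz all by blast
    then obtain m n where mn: "m \<in> M" "n \<in> M" "E m r" "E r n" and rV: "r \<in> V - M"
      using r unfolding N_def by blast
    have "E r m" using hyper_module_replace[OF M zM rV mn(2) all'[OF mn(2)] nz mn(4) mn(1)] by blast
    then show False using asym[of m r] mn rV MV by blast
  qed
  have "arc_module E V N" unfolding arc_module_def
  proof (intro conjI ballI)
    fix z r s assume "z \<in> V - N" "r \<in> N" "s \<in> N"
    then show "E z r \<longleftrightarrow> E z s" using up[of z r] up[of z s] down[of z r] down[of z s] by blast
  qed (auto simp: N_def)
  moreover have "a \<in> N" "b \<in> N" using two MV unfolding N_def by auto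
  ultimately have "N = V" using arc_prime_module_eq[OF P] two(3) by blast
  then show ?thesis using x unfolding N_def by blast
qed

lemma arc_prime_imp_not_decomposable:
  assumes P: "arc_prime E V"
  shows "\<not> hyper_decomposable (cycle_hypergraph E V)"
proof
  assume "hyper_decomposable (cycle_hypergraph E V)"
  then obtain M where M: "hyper_module (cycle_hypergraph E V) M" "\<not> trivial_module (cycle_hypergraph E V) M"
    unfolding hyper_decomposable_def by blast
  have MV: "M \<subseteq> V" using M(1) unfolding hyper_module_def by simp
  then have nt: "M \<noteq> {}" "M \<noteq> V" "\<And>v. M \<noteq> {v}" using M(2) by (simp_all add: trivial_module_iff)
  obtain a where a: "a \<in> M" using nt(1) by blast
  obtain b where b: "b \<in> M" "b \<noteq> a" using a nt(3)[of a] by blast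
  note ab = a b(1) b(2)[symmetric]
  obtain y where y: "y \<in> V - M" using MV nt(2) by blast
  define A where "A x = {m \<in> M. E m x}" for x
  have finA: "finite (A x)" for x using fin MV finite_subset unfolding A_def by fastforce
  obtain x where x: "x \<in> V - M" and mn: "\<And>z. z \<in> V - M \<Longrightarrow> card (A x) \<le> card (A z)"
    using ex_has_least_nat[of "\<lambda>z. z \<in> V - M" y "\<lambda>z. card (A z)"] y by blast
  \<comment> \<open>A smallest set in cardinality is smallest under inclusion: two incomparable sets
    would give \<open>u\<close> and \<open>v\<close> in \<open>M\<close> that dominate each other by
    \<open>hyper_module_split\<close>.\<close>
  have least: "A x \<subseteq> A z" if z: "z \<in> V - M" for z
  proof (rule ccontr)
    assume "\<not> A x \<subseteq> A z"
    then obtain u where u: "u \<in> A x" "u \<notin> A z" by blast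
    have "\<not> A z \<subseteq> A x"
    proof
      assume "A z \<subseteq> A x"
      then have "A z \<subset> A x" using u by blast
      then show False using mn[OF z] psubset_card_mono[OF finA, of "A z" x] by simp
    qed
    then obtain v where v: "v \<in> A z" "v \<notin> A x" by blast
    have uv: "u \<in> M" "v \<in> M" "E u x" "E v z" "\<not> E u z" "\<not> E v x" using u v unfolding A_def by auto
    then have "E x v" "E z u" using asym[of v x] asym[of u z] x z MV by blast+
    then have "E u v" "E v u" using hyper_module_split[OF M(1)] uv x z by blast+
    then show False using asym[of u v] irrefl[of u] uv MV by blast
  qed
  obtain m n where mn: "m \<in> M" "n \<in> M" "E m x" "E x n" using hyper_module_mixed[OF P M(1) ab x] by blast
  have nA: "n \<notin> A x" using asym[of n x] irrefl[of n] mn x MV unfolding A_def by blast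
  \<comment> \<open>Inside \<open>M\<close>, the vertices not in \<open>A x\<close> are
    out-neighbours of \<open>x\<close>, so \<open>hyper_module_split\<close> applies; outside
    \<open>M\<close>, this is \<open>least\<close>.\<close>
  have dom: "E u z" if u: "u \<in> A x" and z: "z \<in> V - A x" for u z
  proof (cases "z \<in> M")
    case True
    then have "E x z" using asym[of x z] x z MV unfolding A_def by blast
    then show ?thesis using hyper_module_split[OF M(1) x _ True] u unfolding A_def by blast
  next
    case False
    then show ?thesis using least[of z] u z unfolding A_def by blast
  qed
  have "arc_module E V (V - A x)" unfolding arc_module_def
  proof (intro conjI ballI)
    fix u r s assume "u \<in> V - (V - A x)" "r \<in> V - A x" "s \<in> V - A x"
    then show "E u r \<longleftrightarrow> E u s" using dom[of u r] dom[of u s] by blast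
  qed blast
  moreover have "n \<in> V - A x" "x \<in> V - A x" "n \<noteq> x"  using mn x nA MV by (auto simp: A_def)
  ultimately have "V - A x = V" using arc_prime_module_eq[OF P, of "V - A x" n x] by blast
  moreover have "m \<in> A x" using mn unfolding A_def by blast
  moreover have "m \<in> V" using mn MV by blast
  ultimately show False by blast
qed

end

section \<open>Transfer between the digraph definitions and cyclic triples\<close>

lemma tournament_imp_arc_tournament:
  assumes "tournament T"
  shows "arc_tournament (\<lambda>x y. (x, y) \<in> parcs T) (pverts T)"
proof -
  interpret pair_digraph T using assms unfolding tournament_def by blast
  show ?thesis
  proof
    show "(x, x) \<notin> parcs T" for x using pair_no_loops[of "(x, x)"] by auto
    show "(x, y) \<in> parcs T \<longleftrightarrow> (y, x) \<notin> parcs T" if "x \<in> pverts T" "y \<in> pverts T" "x \<noteq> y" for x y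
      using assms that unfolding tournament_def by blast
  qed (rule pair_finite_verts)
qed

lemma tournamentI:
  assumes "finite (pverts T)" "parcs T \<subseteq> pverts T \<times> pverts T" "\<And>x. (x, x) \<notin> parcs T"
    and "\<And>x y. x \<in> pverts T \<Longrightarrow> y \<in> pverts T \<Longrightarrow> x \<noteq> y \<Longrightarrow> (x, y) \<in> parcs T \<longleftrightarrow> (y, x) \<notin> parcs T"
  shows "tournament T"
proof -
  have "finite (parcs T)" using assms(1,2) finite_subset by blast
  have "pair_digraph T"
  proof
    show "fst e \<in> pverts T" "snd e \<in> pverts T" "fst e \<noteq> snd e" if "e \<in> parcs T" for e
      using that assms(2,3) by (cases e; auto)+
  qed fact+
  then show ?thesis unfolding tournament_def using assms(4) by blast
qed

lemma C3_eq_cycle_hypergraph: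
  assumes T: "tournament T"
  shows "C3 T = cycle_hypergraph (\<lambda>x y. (x, y) \<in> parcs T) (pverts T)"
proof -
  interpret t: arc_tournament "\<lambda>x y. (x, y) \<in> parcs T" "pverts T"
    by (rule tournament_imp_arc_tournament[OF T])
  have "X \<subseteq> pverts T \<and> card X = 3 \<and> digraph_iso (with_proj T \<restriction> X) (with_proj three_cycle) \<longleftrightarrow>
      (\<exists>a b c. X = {a, b, c} \<and> a \<in> pverts T \<and> b \<in> pverts T \<and> c \<in> pverts T \<and>
        (a, b) \<in> parcs T \<and> (b, c) \<in> parcs T \<and> (c, a) \<in> parcs T)" (is "?L \<longleftrightarrow> ?R") for X
  proof
    assume L: ?L
    then obtain f where f: "pre_digraph.digraph_isomorphism (with_proj T \<restriction> X) f"
      "with_proj three_cycle = app_iso f (with_proj T \<restriction> X)"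
      unfolding digraph_iso_def by blast
    have inj: "inj_on (iso_verts f) X"
      using f(1) unfolding pre_digraph.digraph_isomorphism_def by simp
    have vs: "iso_verts f ` X = {0, 1, 2}"
      using arg_cong[OF f(2), of verts] by (simp add: with_proj_def three_cycle_def)
    have ar: "iso_arcs f ` arcs (with_proj T \<restriction> X) = {(0, 1), (1, 2), (2, 0)}"
      using arg_cong[OF f(2), of arcs] by (simp add: with_proj_def three_cycle_def)
    have tl: "iso_tail f = fst" "iso_head f = snd"
      using arg_cong[OF f(2), of tail] arg_cong[OF f(2), of head] by (simp_all add: with_proj_def)
    \<comment> \<open>Each of the three arcs of \<open>three_cycle\<close> is pulled back
      separately; injectivity on vertices later glues the endpoints with equal labels.\<close>
    have ex: "\<exists>a b. (a, b) \<in> parcs T \<and> a \<in> X \<and> b \<in> X \<and> iso_verts f a = i \<and> iso_verts f b = j"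
      if "(i, j) \<in> {(0, 1), (1, 2), (2, 0)}" for i j
    proof -
      have "(i, j) \<in> iso_arcs f ` arcs (with_proj T \<restriction> X)" unfolding ar by (rule that)
      then obtain e where e: "e \<in> arcs (with_proj T \<restriction> X)" "iso_arcs f e = (i, j)" by fastforce
      then have "iso_verts f (fst e) = i" "iso_verts f (snd e) = j"
        using f(1) tl unfolding pre_digraph.digraph_isomorphism_def by (cases e; auto simp: with_proj_def)+
      then show ?thesis using e(1) by (cases e) (auto simp: with_proj_def)
    qed
    obtain a b where ab: "(a, b) \<in> parcs T" "a \<in> X" "b \<in> X" "iso_verts f a = 0" "iso_verts f b = 1"
      using ex[of 0 1] by auto
    obtain b' c where bc: "(b', c) \<in> parcs T" "b' \<in> X" "c \<in> X" "iso_verts f b' = 1" "iso_verts f c = 2"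
      using ex[of 1 2] by auto
    obtain c' a' where ca: "(c', a') \<in> parcs T" "c' \<in> X" "a' \<in> X" "iso_verts f c' = 2" "iso_verts f a' = 0"
      using ex[of 2 0] by auto
    have eq: "b' = b" "c' = c" "a' = a" using inj_onD[OF inj] ab bc ca by metis+
    have "x \<in> {a, b, c}" if "x \<in> X" for x
    proof -
      have "iso_verts f x \<in> {0, 1, 2}" using vs that by blast
      then show ?thesis using inj_onD[OF inj _ that] ab bc ca by auto
    qed
    then have "X = {a, b, c}" using ab bc by blast
    then show ?R using ab bc ca eq L by blast
  next
    assume ?R
    then obtain a b c where abc: "X = {a, b, c}" "a \<in> pverts T" "b \<in> pverts T" "c \<in> pverts T"
      "(a, b) \<in> parcs T" "(b, c) \<in> parcs T" "(c, a) \<in> parcs T" by blast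
    then have d: "a \<noteq> b" "b \<noteq> c" "a \<noteq> c" using t.cycle_distinct by blast+
    define g where "g x = (if x = a then 0 else if x = b then 1 else 2 :: nat)" for x
    \<comment> \<open>The target is an equality of whole digraph records, so \<open>f\<close> must
      also prescribe the tail and head functions, here the two projections.\<close>
    define f where "f = \<lparr>iso_verts = g, iso_arcs = map_prod g g, iso_head = snd, iso_tail = fst\<rparr>"
    have ar: "arcs (with_proj T \<restriction> X) = {(a, b), (b, c), (c, a)}"
      using abc d t.asym[of a b] t.asym[of b c] t.asym[of c a] t.irrefl by (auto simp: with_proj_def)
    have g: "g a = 0" "g b = 1" "g c = 2" using d unfolding g_def by auto
    have "wf_digraph (with_proj T \<restriction> X)"
      by unfold_locales (auto simp: with_proj_def)
    moreover have "inj_on g X" using g abc(1) by (auto simp: inj_on_def)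
    moreover have "inj_on (map_prod g g) (arcs (with_proj T \<restriction> X))"
      unfolding ar using g d by (auto simp: inj_on_def)
    ultimately have "pre_digraph.digraph_isomorphism (with_proj T \<restriction> X) f"
      unfolding pre_digraph.digraph_isomorphism_def f_def by (auto simp: with_proj_def)
    moreover have "with_proj three_cycle = app_iso f (with_proj T \<restriction> X)"
      using abc(1) g ar unfolding app_iso_def f_def by (simp add: with_proj_def three_cycle_def)
    ultimately have "digraph_iso (with_proj T \<restriction> X) (with_proj three_cycle)"
      unfolding digraph_iso_def by blast
    then show ?L using abc d by auto
  qed
  then show ?thesis unfolding C3_def cycle_hypergraph_def by auto
qed

lemma image_cycle_edges:
  assumes "bij_betw f V W" and E: "\<And>x y. x \<in> V \<Longrightarrow> y \<in> V \<Longrightarrow> E x y \<longleftrightarrow> F (f x) (f y)"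
  shows "hedges (cycle_hypergraph F W) = (\<lambda>e. f ` e) ` hedges (cycle_hypergraph E V)"
proof (intro subset_antisym subsetI)
  have W: "W = f ` V" using assms(1) by (simp add: bij_betw_def)
  fix e assume "e \<in> hedges (cycle_hypergraph F W)"
  then obtain a b c where abc: "e = {f a, f b, f c}" "a \<in> V" "b \<in> V" "c \<in> V"
    "F (f a) (f b)" "F (f b) (f c)" "F (f c) (f a)"
    unfolding cycle_hypergraph_def W by auto
  then have "{a, b, c} \<in> hedges (cycle_hypergraph E V)" by (intro cycle_edgeI) (simp_all add: E)
  moreover have "e = f ` {a, b, c}" using abc by simp
  ultimately show "e \<in> (\<lambda>e. f ` e) ` hedges (cycle_hypergraph E V)" by blast
next
  have W: "W = f ` V" using assms(1) by (simp add: bij_betw_def)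
  fix e assume "e \<in> (\<lambda>e. f ` e) ` hedges (cycle_hypergraph E V)"
  then obtain a b c where abc: "e = f ` {a, b, c}" "a \<in> V" "b \<in> V" "c \<in> V" "E a b" "E b c" "E c a"
    unfolding cycle_hypergraph_def by auto
  then have "{f a, f b, f c} \<in> hedges (cycle_hypergraph F W)"
    using W E[of a b] E[of b c] E[of c a] by (intro cycle_edgeI) auto
  then show "e \<in> hedges (cycle_hypergraph F W)" using abc(1) by simp
qed

text \<open>The arcs need to be compared only for \<open>i < j\<close>, which is how the normal
  forms are stated; asymmetry on both sides supplies the rest. The isomorphism is the inverse of the
  enumeration \<open>q\<close>.\<close>

lemma hyper_iso_C3:
  fixes T :: "nat pair_pre_digraph"
  assumes t: "arc_tournament E V" and T: "tournament T" and q: "bij_betw q {0..<n} V"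
    and n: "pverts T = {0..<n}"
    and E: "\<And>i j. i < j \<Longrightarrow> j < n \<Longrightarrow> E (q i) (q j) \<longleftrightarrow> (i, j) \<in> parcs T"
  shows "hyper_iso (cycle_hypergraph E V) (C3 T)"
proof -
  interpret t: arc_tournament E V by (rule t)
  interpret T: arc_tournament "\<lambda>x y. (x, y) \<in> parcs T" "pverts T"
    by (rule tournament_imp_arc_tournament[OF T])
  have qV: "q i \<in> V" if "i < n" for i using bij_betwE[OF q] that by simp
  have qe: "q i = q j \<longleftrightarrow> i = j" if "i < n" "j < n" for i j
    using q that by (auto simp: bij_betw_def inj_on_def)
  have all: "E (q i) (q j) \<longleftrightarrow> (i, j) \<in> parcs T" if "i < n" "j < n" for i j
  proof (cases i j rule: linorder_cases)
    case greater
    then show ?thesis using E[of j i] t.asym[of "q i" "q j"] T.asym[of i j] qV qe that n by auto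
  qed (use E t.irrefl T.irrefl qV that n in auto)
  let ?f = "the_inv_into {0..<n} q"
  have f: "bij_betw ?f V {0..<n}" using q by (rule bij_betw_the_inv_into)
  moreover have "E x y \<longleftrightarrow> (?f x, ?f y) \<in> parcs T" if "x \<in> V" "y \<in> V" for x y
  proof -
    have "?f x < n" "?f y < n" using f that by (auto dest: bij_betwE)
    moreover have "q (?f x) = x" "q (?f y) = y"
      using f_the_inv_into_f[of q "{0..<n}"] q that by (auto simp: bij_betw_def)
    ultimately show ?thesis using all by metis
  qed
  ultimately show ?thesis
    using image_cycle_edges[of ?f V "{0..<n}" E "\<lambda>x y. (x, y) \<in> parcs T"]
    unfolding hyper_iso_def C3_eq_cycle_hypergraph[OF T] n by auto
qed

text \<open>The arcs of \<open>T\<close> are pulled back along the isomorphism. The edge sets of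
  \<open>C3 S\<close> and \<open>H\<close> then have the same image, and taking images is injective
  on subsets of \<open>hverts H\<close>.\<close>

lemma realizable_if_iso:
  assumes H: "hypergraph3 H" and T: "tournament T" and iso: "hyper_iso H (C3 T)"
  shows "realizable H"
proof -
  interpret T: arc_tournament "\<lambda>x y. (x, y) \<in> parcs T" "pverts T"
    by (rule tournament_imp_arc_tournament[OF T])
  obtain f where f: "bij_betw f (hverts H) (pverts T)" "hedges (C3 T) = (\<lambda>e. f ` e) ` hedges H"
    using iso unfolding hyper_iso_def C3_eq_cycle_hypergraph[OF T] by auto
  define S where "S = \<lparr>pverts = hverts H, parcs = {(x, y). x \<in> hverts H \<and> y \<in> hverts H \<and> (f x, f y) \<in> parcs T}\<rparr>"
  have fV: "f x \<in> pverts T" if "x \<in> hverts H" for x using f(1) that by (auto dest: bij_betwE)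
  have fe: "f x = f y \<longleftrightarrow> x = y" if "x \<in> hverts H" "y \<in> hverts H" for x y
    using f(1) that by (auto simp: bij_betw_def inj_on_def)
  have S: "tournament S"
  proof (rule tournamentI)
    show "finite (pverts S)" using H unfolding S_def hypergraph3_def by simp
    show "(x, x) \<notin> parcs S" for x using T.irrefl fV unfolding S_def by auto
    show "(x, y) \<in> parcs S \<longleftrightarrow> (y, x) \<notin> parcs S"
      if "x \<in> pverts S" "y \<in> pverts S" "x \<noteq> y" for x y
      using that T.asym[of "f x" "f y"] fV fe unfolding S_def by auto
  qed (auto simp: S_def)
  have sub: "hedges H \<subseteq> Pow (hverts H)" using H unfolding hypergraph3_def by auto
  have CS: "C3 S = cycle_hypergraph (\<lambda>x y. (x, y) \<in> parcs S) (hverts H)"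
    using C3_eq_cycle_hypergraph[OF S] unfolding S_def by simp
  have subS: "hedges (C3 S) \<subseteq> Pow (hverts H)" unfolding CS cycle_hypergraph_def by auto
  have "(\<lambda>e. f ` e) ` hedges (C3 S) = (\<lambda>e. f ` e) ` hedges H"
    unfolding f(2)[symmetric] CS C3_eq_cycle_hypergraph[OF T]
    by (rule image_cycle_edges[OF f(1), symmetric]) (simp add: S_def)
  moreover have inj: "inj_on (\<lambda>e. f ` e) (Pow (hverts H))"
    using f(1) by (simp add: bij_betw_def inj_on_image_Pow)
  ultimately have "hedges (C3 S) = hedges H"
    using inj_on_image_eq_iff[OF inj subS sub] by blast
  then have "H = C3 S" unfolding CS cycle_hypergraph_def by simp
  then show ?thesis using S unfolding realizable_def realization_def S_def by auto
qed

section \<open>The tournaments on initial segments of the naturals and the final equivalence\<close>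

lemma tournament_L: "tournament (tour_L m)"
  by (rule tournamentI) (auto simp: tour_L_def)

lemma tournament_reverse_between:
  assumes "tournament T"
  shows "tournament (reverse_between A B T)"
proof -
  interpret pair_digraph T using assms unfolding tournament_def by blast
  interpret T: arc_tournament "\<lambda>x y. (x, y) \<in> parcs T" "pverts T"
    by (rule tournament_imp_arc_tournament[OF assms])
  show ?thesis
  proof (rule tournamentI)
    show "(x, x) \<notin> parcs (reverse_between A B T)" for x
      using pair_no_loops[of "(x, x)"] by (auto simp: reverse_between_def)
    show "(x, y) \<in> parcs (reverse_between A B T) \<longleftrightarrow> (y, x) \<notin> parcs (reverse_between A B T)"
      if "x \<in> pverts (reverse_between A B T)" "y \<in> pverts (reverse_between A B T)" "x \<noteq> y" for x y
      using that T.asym[of x y] by (auto simp: reverse_between_def)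
  qed (auto simp: reverse_between_def pair_finite_verts dest: in_arcsD1 in_arcsD2 split: if_splits)
qed

text \<open>The right-hand sides are the three patterns of \<open>classification\<close>, which
  makes the identification immediate.\<close>

lemma parcs_tours:
  assumes "i < j" "j < m"
  shows "(i, j) \<in> parcs (tour_T m) \<longleftrightarrow> (even i \<longleftrightarrow> even j)"
    and "(i, j) \<in> parcs (tour_U m) \<longleftrightarrow> \<not> (even i \<and> even j)"
    and "(i, j) \<in> parcs (tour_W m) \<longleftrightarrow> \<not> (j = m - 1 \<and> even i)"
  using assms by (auto simp: tour_T_def tour_U_def tour_W_def tour_L_def reverse_between_def)

lemma pverts_tours:
  "pverts (tour_T m) = {0..<m}" "pverts (tour_U m) = {0..<m}" "pverts (tour_W m) = {0..<m}"
  by (simp_all add: tour_T_def tour_U_def tour_W_def tour_L_def reverse_between_def)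

lemma tournament_tours: "tournament (tour_T m)" "tournament (tour_U m)" "tournament (tour_W m)"
  unfolding tour_T_def tour_U_def tour_W_def
  by (intro tournament_reverse_between tournament_L)+

text \<open>On three vertices a deletion leaves two, and every subset of a two-element vertex set is
  trivial, so the deletion is not decomposable. This supplies \<open>card4\<close>.\<close>

lemma hyper_critical_card:
  assumes "hyper_critical H"
  shows "card (hverts H) \<ge> 4"
proof (rule ccontr)
  assume "\<not> card (hverts H) \<ge> 4"
  then have c: "card (hverts H) = 3"
    using assms unfolding hyper_critical_def hyper_prime_def by linarith
  then obtain v where v: "v \<in> hverts H" by fastforce
  have fin: "finite (hverts H)" using c by (metis card.infinite zero_neq_numeral)
  let ?D = "hyper_del H v"
  have D: "hverts ?D = hverts H - {v}" unfolding hyper_del_def hyper_induced_def by simp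
  obtain M where M: "M \<subseteq> hverts ?D" "\<not> trivial_module ?D M"
    using assms v unfolding hyper_critical_def hyper_decomposable_def hyper_module_def by blast
  then have nt: "M \<noteq> {}" "M \<noteq> hverts ?D" "\<And>x. M \<noteq> {x}" by (simp_all add: trivial_module_iff)
  have "card (hverts ?D) = 2" using c v fin D by simp
  then have "card M < 2" using psubset_card_mono[of "hverts ?D" M] M(1) nt(2) fin D by auto
  moreover have "finite M" using M(1) fin D finite_subset by fastforce
  then have "card M \<noteq> 0" using nt(1) by simp
  ultimately have "card M = 1" by linarith
  then show False using nt(3) by (metis card_1_singletonE)
qed

theorem theorem53:
  fixes H :: "'a hypergraph"
  assumes "hypergraph3 H" and "hyper_critical H"
  shows "realizable H \<longleftrightarrow>
    odd (card (hverts H)) \<and>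
    (hyper_iso H (C3 (tour_T (card (hverts H)))) \<or>
     hyper_iso H (C3 (tour_U (card (hverts H)))) \<or>
     hyper_iso H (C3 (tour_W (card (hverts H)))))"
proof
  assume "realizable H"
  then obtain T where T: "tournament T" "pverts T = hverts H" "H = C3 T"
    unfolding realizable_def realization_def by blast
  define E where "E x y \<longleftrightarrow> (x, y) \<in> parcs T" for x y
  define V where "V = hverts H"
  have H: "H = cycle_hypergraph E V"
    using C3_eq_cycle_hypergraph[OF T(1)] T unfolding E_def V_def by simp
  have t: "arc_tournament E V"
    using tournament_imp_arc_tournament[OF T(1)] T(2) unfolding E_def V_def by simp
  \<comment> \<open>Primality passes from \<open>H\<close> to the tournament because its modules are
    modules of \<open>H\<close>. Criticality uses the converse for each deletion: were
    \<open>V - {v}\<close> prime, its hypergraph would not be decomposable.\<close>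
  interpret critical_tournament E V
  proof (intro critical_tournament.intro critical_tournament_axioms.intro t)
    show "arc_prime E V"
      using arc_tournament.hyper_prime_imp_arc_prime[OF t] assms(2) H unfolding hyper_critical_def by simp
    show "card V \<ge> 4" using hyper_critical_card[OF assms(2)] unfolding V_def .
    fix v assume v: "v \<in> V"
    then have "hyper_decomposable (cycle_hypergraph E (V - {v}))"
      using assms(2) unfolding hyper_critical_def H hyper_del_cycle_hypergraph by simp
    moreover have "arc_tournament E (V - {v})" by (rule arc_tournament.sub[OF t]) blast
    ultimately show "\<not> arc_prime E (V - {v})" using arc_tournament.arc_prime_imp_not_decomposable by blast
  qed
  obtain q where q: "bij_betw q {..<card V} V"
    "(\<forall>i j. i < j \<longrightarrow> j < card V \<longrightarrow> (E (q i) (q j) \<longleftrightarrow> (even i \<longleftrightarrow> even j))) \<or>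
     (\<forall>i j. i < j \<longrightarrow> j < card V \<longrightarrow> (E (q i) (q j) \<longleftrightarrow> \<not> (even i \<and> even j))) \<or>
     (\<forall>i j. i < j \<longrightarrow> j < card V \<longrightarrow> (E (q i) (q j) \<longleftrightarrow> \<not> (j = card V - 1 \<and> even i)))"
    by (rule classification)
  have q0: "bij_betw q {0..<card V} V" using q(1) by (simp add: atLeast0LessThan)
  note iso = hyper_iso_C3[OF t _ q0]
  have "hyper_iso H (C3 (tour_T (card V))) \<or> hyper_iso H (C3 (tour_U (card V))) \<or>
      hyper_iso H (C3 (tour_W (card V)))"
    using q(2)
  proof (elim disjE)
    assume "\<forall>i j. i < j \<longrightarrow> j < card V \<longrightarrow> (E (q i) (q j) \<longleftrightarrow> (even i \<longleftrightarrow> even j))"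
    then show ?thesis unfolding H
      using iso[OF tournament_tours(1) pverts_tours(1)] by (simp add: parcs_tours(1))
  next
    assume "\<forall>i j. i < j \<longrightarrow> j < card V \<longrightarrow> (E (q i) (q j) \<longleftrightarrow> \<not> (even i \<and> even j))"
    then show ?thesis unfolding H
      using iso[OF tournament_tours(2) pverts_tours(2)] by (simp add: parcs_tours(2))
  next
    assume "\<forall>i j. i < j \<longrightarrow> j < card V \<longrightarrow> (E (q i) (q j) \<longleftrightarrow> \<not> (j = card V - 1 \<and> even i))"
    then show ?thesis unfolding H
      using iso[OF tournament_tours(3) pverts_tours(3)] by (simp add: parcs_tours(3))
  qed
  then show "odd (card (hverts H)) \<and>
    (hyper_iso H (C3 (tour_T (card (hverts H)))) \<or>
     hyper_iso H (C3 (tour_U (card (hverts H)))) \<or>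
     hyper_iso H (C3 (tour_W (card (hverts H)))))"
    using odd_card_ex_nb unfolding V_def by blast
next
  assume "odd (card (hverts H)) \<and>
    (hyper_iso H (C3 (tour_T (card (hverts H)))) \<or>
     hyper_iso H (C3 (tour_U (card (hverts H)))) \<or>
     hyper_iso H (C3 (tour_W (card (hverts H)))))"
  then show "realizable H" using realizable_if_iso[OF assms(1)] tournament_tours by blast
qed

end
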